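(* Let $\alpha\in(0,1)$, let $\Omega\subset\mathbb{R}^d$ ($d\in\mathbb{N}$) be a bounded domain with sufficiently smooth boundary, let $\eta\in\mathbb{R}^d$ be a constant vector, and let $H(u)=(\eta\cdot\nabla)u=\sum_{j=1}^d\eta_j\,\partial u/\partial x_j$. Let $\mathscr{T}\in(0,\infty)$, $I=[0,\mathscr{T}]$, and $u_0\in D^1(\Omega)$. Suppose that the problem $$\partial_t^\alpha u-\partial_t^\alpha\Delta u-\Delta u=H(u)\ \text{ in }\Omega\times(0,\infty),\qquad u=0\ \text{ on }\partial\Omega\times(0,\infty),\qquad u(\cdot,0)=u_0\ \text{ in }\Omega,$$ admits a mild solution $u$ in $C(I\to D^1(\Omega))$. Then this solution is globally unique. Furthermore, it depends continuously on the initial data.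
   Context: $\partial_t^\alpha$ is the Caputo time derivative of order $\alpha$. Let $0<\theta_1\le\theta_2\le\dots$ be the eigenvalues of $-\Delta$ on $\Omega$ with homogeneous Dirichlet condition, and $\{\phi_k\}_{k\in\mathbb{N}}$ corresponding eigenfunctions forming a complete orthonormal system of $L^2(\Omega)$; $\langle w,v\rangle=\int_\Omega wv\,dz$. For $\nu\ge 0$, $D^\nu(\Omega)=\{w\in L^2(\Omega): \|w\|_{D^\nu(\Omega)}^2=\sum_{k}\theta_k^\nu\langle w,\phi_k\rangle^2<\infty\}$. For a Banach space $X$ and a compact interval $I$, $C(I\to X)$ is the space of continuous functions $w:I\to X$ with norm $\sup_{t\in I}\|w(t)\|_X$. The Mittag-Leffler functions are $E_{\alpha,\zeta}(z)=\sum_{k=0}^\infty z^k/\Gamma(\alpha k+\zeta)$ and $E_\alpha=E_{\alpha,1}$. Define $$\mathscr{S}(t)w=\sum_{k=1}^\infty E_\alpha\Big(\frac{-\theta_kt^\alpha}{1+\theta_k}\Big)\langle w,\phi_k\rangle\phi_k,\qquad \mathscr{R}(t)w=\sum_{k=1}^\infty\frac{t^{\alpha-1}}{1+\theta_k}E_{\alpha,\alpha}\Big(\frac{-\theta_kt^\alpha}{1+\theta_k}\Big)\langle w,\phi_k\rangle\phi_k .$$ A mild solution on $I=[0,\mathscr{T}]$ is a function $u$ satisfying, for $t\in I$, $$u(t)=\mathscr{S}(t)u_0+\int_0^t\mathscr{R}(t-\tau)H(u(\tau))\,d\tau .$$ *)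

theory Defs
  imports "HOL-Analysis.Analysis"
begin

section \<open>Smooth functions and smooth bounded domains\<close>

abbreviation partial_deriv :: "'d::finite \<Rightarrow> (real^'d \<Rightarrow> real) \<Rightarrow> real^'d \<Rightarrow> real" where
  "partial_deriv j f \<equiv> (\<lambda>x. frechet_derivative f (at x) (axis j 1))"

primrec C_k :: "nat \<Rightarrow> (real^'d::finite \<Rightarrow> real) \<Rightarrow> bool" where
  "C_k 0 f \<longleftrightarrow> continuous_on UNIV f"
| "C_k (Suc k) f \<longleftrightarrow> (\<forall>x. f differentiable (at x)) \<and> (\<forall>j. C_k k (partial_deriv j f))"

text \<open>Near each of its points the boundary is the graph of a \<open>C^k\<close> function over the
  hyperplane orthogonal to some unit vector \<open>n\<close>, with the domain on one side.  A function on
  that hyperplane is represented by a function on the whole space that is constant along \<open>n\<close>.\<close>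

definition C_k_boundary :: "nat \<Rightarrow> (real^'d::finite) set \<Rightarrow> bool" where
  "C_k_boundary k \<Omega> \<longleftrightarrow>
     (\<forall>p\<in>frontier \<Omega>. \<exists>r>0. \<exists>n \<gamma>. norm n = 1 \<and> C_k k \<gamma> \<and>
        (\<forall>x s. \<gamma> (x + s *\<^sub>R n) = \<gamma> x) \<and>
        \<Omega> \<inter> ball p r = {x \<in> ball p r. x \<bullet> n > \<gamma> x})"

definition bounded_smooth_domain :: "(real^'d::finite) set \<Rightarrow> bool" where
  "bounded_smooth_domain \<Omega> \<longleftrightarrow>
     open \<Omega> \<and> connected \<Omega> \<and> \<Omega> \<noteq> {} \<and> bounded \<Omega> \<and> C_k_boundary 2 \<Omega>"

section \<open>The space of square-integrable functions\<close>

text \<open>Elements of \<open>L\<^sup>2(\<Omega>)\<close> are represented by functions on the whole space whose values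
  outside \<open>\<Omega>\<close> are irrelevant; equality in \<open>L\<^sup>2(\<Omega>)\<close> is \<open>L2_eq\<close>.\<close>

definition L2 :: "(real^'d::finite) set \<Rightarrow> (real^'d \<Rightarrow> real) set" where
  "L2 \<Omega> = {w. w \<in> borel_measurable (lebesgue_on \<Omega>) \<and> integrable (lebesgue_on \<Omega>) (\<lambda>x. (w x)\<^sup>2)}"

definition L2_eq :: "(real^'d::finite) set \<Rightarrow> (real^'d \<Rightarrow> real) \<Rightarrow> (real^'d \<Rightarrow> real) \<Rightarrow> bool" where
  "L2_eq \<Omega> w v \<longleftrightarrow> (AE x in lebesgue_on \<Omega>. w x = v x)"

definition L2_inner :: "(real^'d::finite) set \<Rightarrow> (real^'d \<Rightarrow> real) \<Rightarrow> (real^'d \<Rightarrow> real) \<Rightarrow> real" where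
  "L2_inner \<Omega> w v = (\<integral>x. w x * v x \<partial>lebesgue_on \<Omega>)"

definition L2_norm :: "(real^'d::finite) set \<Rightarrow> (real^'d \<Rightarrow> real) \<Rightarrow> real" where
  "L2_norm \<Omega> w = sqrt (L2_inner \<Omega> w w)"

definition L2_tendsto ::
  "(real^'d::finite) set \<Rightarrow> (nat \<Rightarrow> real^'d \<Rightarrow> real) \<Rightarrow> (real^'d \<Rightarrow> real) \<Rightarrow> bool" where
  "L2_tendsto \<Omega> f g \<longleftrightarrow>
     (\<forall>n. f n \<in> L2 \<Omega>) \<and> g \<in> L2 \<Omega> \<and> (\<lambda>n. L2_norm \<Omega> (\<lambda>x. f n x - g x)) \<longlonglongrightarrow> 0"

definition L2_suminf ::
  "(real^'d::finite) set \<Rightarrow> (nat \<Rightarrow> real^'d \<Rightarrow> real) \<Rightarrow> real^'d \<Rightarrow> real" where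
  "L2_suminf \<Omega> f = (SOME g. L2_tendsto \<Omega> (\<lambda>n x. \<Sum>k<n. f k x) g)"

text \<open>Bochner integral of an \<open>L\<^sup>2(\<Omega>)\<close>-valued function \<open>F\<close> with respect to the measure \<open>M\<close>.
  (The library's Bochner integral needs a Banach space that is a type, which is not available
  for \<open>L\<^sup>2(\<Omega>)\<close> with a variable set \<open>\<Omega>\<close>.)
  \<open>L2_simple \<Omega> M s p\<close>: \<open>s\<close> is a simple function whose integral is \<open>p\<close>.
  The almost everywhere convergence is strong measurability of \<open>F\<close>.\<close>

definition L2_simple ::
  "(real^'d::finite) set \<Rightarrow> real measure \<Rightarrow> (real \<Rightarrow> real^'d \<Rightarrow> real) \<Rightarrow> (real^'d \<Rightarrow> real) \<Rightarrow> bool" where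
  "L2_simple \<Omega> M s p \<longleftrightarrow>
     (\<exists>(m::nat) A w. (\<forall>i<m. A i \<in> sets M \<and> emeasure M (A i) < \<infinity> \<and> w i \<in> L2 \<Omega>) \<and>
        s = (\<lambda>\<tau> x. \<Sum>i<m. indicator (A i) \<tau> * w i x) \<and>
        p = (\<lambda>x. \<Sum>i<m. measure M (A i) * w i x))"

definition has_L2_integral ::
  "(real^'d::finite) set \<Rightarrow> real measure \<Rightarrow> (real \<Rightarrow> real^'d \<Rightarrow> real) \<Rightarrow> (real^'d \<Rightarrow> real) \<Rightarrow> bool" where
  "has_L2_integral \<Omega> M F g \<longleftrightarrow>
     (\<forall>\<tau>\<in>space M. F \<tau> \<in> L2 \<Omega>) \<and>
     (\<exists>s p. (\<forall>n. L2_simple \<Omega> M (s n) (p n)) \<and>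
        (AE \<tau> in M. L2_tendsto \<Omega> (\<lambda>n. s n \<tau>) (F \<tau>)) \<and>
        (\<lambda>n. \<integral>\<^sup>+\<tau>. ennreal (L2_norm \<Omega> (\<lambda>x. s n \<tau> x - F \<tau> x)) \<partial>M) \<longlonglongrightarrow> 0 \<and>
        L2_tendsto \<Omega> p g)"

section \<open>Weak derivatives and the Dirichlet Laplacian\<close>

definition test_fun :: "(real^'d::finite) set \<Rightarrow> (real^'d \<Rightarrow> real) set" where
  "test_fun \<Omega> =
     {\<psi>. (\<forall>k. C_k k \<psi>) \<and> compact (closure {x. \<psi> x \<noteq> 0}) \<and> closure {x. \<psi> x \<noteq> 0} \<subseteq> \<Omega>}"

definition has_weak_partial ::
  "(real^'d::finite) set \<Rightarrow> 'd \<Rightarrow> (real^'d \<Rightarrow> real) \<Rightarrow> (real^'d \<Rightarrow> real) \<Rightarrow> bool" where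
  "has_weak_partial \<Omega> j w g \<longleftrightarrow>
     g \<in> L2 \<Omega> \<and> (\<forall>\<psi>\<in>test_fun \<Omega>. L2_inner \<Omega> w (partial_deriv j \<psi>) = - L2_inner \<Omega> g \<psi>)"

definition weak_partial :: "(real^'d::finite) set \<Rightarrow> 'd \<Rightarrow> (real^'d \<Rightarrow> real) \<Rightarrow> real^'d \<Rightarrow> real" where
  "weak_partial \<Omega> j w = (SOME g. has_weak_partial \<Omega> j w g)"

text \<open>The Sobolev spaces \<open>H\<^sup>1(\<Omega>)\<close> and \<open>H\<^sup>1\<^sub>0(\<Omega>)\<close>, the latter being the closure of the
  test functions in the former; it encodes the homogeneous Dirichlet condition.\<close>

definition H1 :: "(real^'d::finite) set \<Rightarrow> (real^'d \<Rightarrow> real) set" where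
  "H1 \<Omega> = {w \<in> L2 \<Omega>. \<forall>j. \<exists>g. has_weak_partial \<Omega> j w g}"

definition H10 :: "(real^'d::finite) set \<Rightarrow> (real^'d \<Rightarrow> real) set" where
  "H10 \<Omega> = {w \<in> H1 \<Omega>. \<exists>\<psi>. (\<forall>n. \<psi> n \<in> test_fun \<Omega>) \<and> L2_tendsto \<Omega> \<psi> w \<and>
     (\<forall>j. L2_tendsto \<Omega> (\<lambda>n. partial_deriv j (\<psi> n)) (weak_partial \<Omega> j w))}"

text \<open>\<open>-\<Delta>\<phi> = \<theta>\<phi>\<close> in \<open>\<Omega>\<close>, \<open>\<phi> = 0\<close> on the boundary, in the weak (variational) sense.\<close>

definition dirichlet_eigenfunction :: "(real^'d::finite) set \<Rightarrow> real \<Rightarrow> (real^'d \<Rightarrow> real) \<Rightarrow> bool" where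
  "dirichlet_eigenfunction \<Omega> \<theta> \<phi> \<longleftrightarrow>
     \<phi> \<in> H10 \<Omega> \<and> \<not> L2_eq \<Omega> \<phi> (\<lambda>x. 0) \<and>
     (\<forall>v\<in>H10 \<Omega>. (\<Sum>j\<in>UNIV. L2_inner \<Omega> (weak_partial \<Omega> j \<phi>) (weak_partial \<Omega> j v))
        = \<theta> * L2_inner \<Omega> \<phi> v)"

text \<open>Indices start at \<open>0\<close>.  Since the eigenfunctions form a complete orthonormal system,
  \<open>\<theta>\<close> lists all the eigenvalues, with multiplicity.\<close>

definition dirichlet_eigensystem ::
  "(real^'d::finite) set \<Rightarrow> (nat \<Rightarrow> real) \<Rightarrow> (nat \<Rightarrow> real^'d \<Rightarrow> real) \<Rightarrow> bool" where
  "dirichlet_eigensystem \<Omega> \<theta> \<phi> \<longleftrightarrow>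
     0 < \<theta> 0 \<and> mono \<theta> \<and>
     (\<forall>k. dirichlet_eigenfunction \<Omega> (\<theta> k) (\<phi> k)) \<and>
     (\<forall>j k. L2_inner \<Omega> (\<phi> j) (\<phi> k) = (if j = k then 1 else 0)) \<and>
     (\<forall>w\<in>L2 \<Omega>. (\<forall>k. L2_inner \<Omega> w (\<phi> k) = 0) \<longrightarrow> L2_eq \<Omega> w (\<lambda>x. 0))"

section \<open>The spaces \<open>D\<^sup>\<nu>(\<Omega>)\<close> and \<open>C(I \<rightarrow> D\<^sup>\<nu>(\<Omega>))\<close>\<close>

definition D_space ::
  "(real^'d::finite) set \<Rightarrow> (nat \<Rightarrow> real) \<Rightarrow> (nat \<Rightarrow> real^'d \<Rightarrow> real) \<Rightarrow> real \<Rightarrow> (real^'d \<Rightarrow> real) set" where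
  "D_space \<Omega> \<theta> \<phi> \<nu> = {w \<in> L2 \<Omega>. summable (\<lambda>k. \<theta> k powr \<nu> * (L2_inner \<Omega> w (\<phi> k))\<^sup>2)}"

definition D_norm ::
  "(real^'d::finite) set \<Rightarrow> (nat \<Rightarrow> real) \<Rightarrow> (nat \<Rightarrow> real^'d \<Rightarrow> real) \<Rightarrow> real \<Rightarrow> (real^'d \<Rightarrow> real) \<Rightarrow> real" where
  "D_norm \<Omega> \<theta> \<phi> \<nu> w = sqrt (\<Sum>k. \<theta> k powr \<nu> * (L2_inner \<Omega> w (\<phi> k))\<^sup>2)"

definition CD_space ::
  "(real^'d::finite) set \<Rightarrow> (nat \<Rightarrow> real) \<Rightarrow> (nat \<Rightarrow> real^'d \<Rightarrow> real) \<Rightarrow> real \<Rightarrow> real set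
     \<Rightarrow> (real \<Rightarrow> real^'d \<Rightarrow> real) set" where
  "CD_space \<Omega> \<theta> \<phi> \<nu> I =
     {w. \<forall>t\<in>I. w t \<in> D_space \<Omega> \<theta> \<phi> \<nu> \<and>
        ((\<lambda>s. D_norm \<Omega> \<theta> \<phi> \<nu> (\<lambda>x. w s x - w t x)) \<longlongrightarrow> 0) (at t within I)}"

definition CD_norm ::
  "(real^'d::finite) set \<Rightarrow> (nat \<Rightarrow> real) \<Rightarrow> (nat \<Rightarrow> real^'d \<Rightarrow> real) \<Rightarrow> real \<Rightarrow> real set
     \<Rightarrow> (real \<Rightarrow> real^'d \<Rightarrow> real) \<Rightarrow> real" where
  "CD_norm \<Omega> \<theta> \<phi> \<nu> I w = (SUP t\<in>I. D_norm \<Omega> \<theta> \<phi> \<nu> (w t))"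

section \<open>Mild solutions\<close>

definition mittag_leffler :: "real \<Rightarrow> real \<Rightarrow> real \<Rightarrow> real" where
  "mittag_leffler \<alpha> \<zeta> z = (\<Sum>k. z ^ k / Gamma (\<alpha> * real k + \<zeta>))"

definition S_op ::
  "(real^'d::finite) set \<Rightarrow> (nat \<Rightarrow> real) \<Rightarrow> (nat \<Rightarrow> real^'d \<Rightarrow> real) \<Rightarrow> real \<Rightarrow> real
     \<Rightarrow> (real^'d \<Rightarrow> real) \<Rightarrow> real^'d \<Rightarrow> real" where
  "S_op \<Omega> \<theta> \<phi> \<alpha> t w = L2_suminf \<Omega> (\<lambda>k x.
     mittag_leffler \<alpha> 1 (- \<theta> k * t powr \<alpha> / (1 + \<theta> k)) * L2_inner \<Omega> w (\<phi> k) * \<phi> k x)"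

definition R_op ::
  "(real^'d::finite) set \<Rightarrow> (nat \<Rightarrow> real) \<Rightarrow> (nat \<Rightarrow> real^'d \<Rightarrow> real) \<Rightarrow> real \<Rightarrow> real
     \<Rightarrow> (real^'d \<Rightarrow> real) \<Rightarrow> real^'d \<Rightarrow> real" where
  "R_op \<Omega> \<theta> \<phi> \<alpha> t w = L2_suminf \<Omega> (\<lambda>k x.
     t powr (\<alpha> - 1) / (1 + \<theta> k) * mittag_leffler \<alpha> \<alpha> (- \<theta> k * t powr \<alpha> / (1 + \<theta> k))
       * L2_inner \<Omega> w (\<phi> k) * \<phi> k x)"

definition convection :: "(real^'d::finite) set \<Rightarrow> real^'d \<Rightarrow> (real^'d \<Rightarrow> real) \<Rightarrow> real^'d \<Rightarrow> real" where
  "convection \<Omega> \<eta> w = (\<lambda>x. \<Sum>j\<in>UNIV. \<eta> $ j * weak_partial \<Omega> j w x)"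

text \<open>Mild solution on \<open>I = [0,T]\<close>, for a nonlinearity \<open>H\<close> and initial datum \<open>u0\<close>, of
  \<open>\<partial>\<^sub>t\<^sup>\<alpha> u - \<partial>\<^sub>t\<^sup>\<alpha> \<Delta>u - \<Delta>u = H(u)\<close> in \<open>\<Omega>\<close>, \<open>u = 0\<close> on the boundary, \<open>u(0) = u0\<close>,
  with the Caputo derivative of order \<open>\<alpha>\<close>.  The integral is required to exist as a Bochner
  integral in \<open>L\<^sup>2(\<Omega>)\<close>; its integrand at the single point \<open>\<tau> = t\<close> is immaterial (and is zero).\<close>

definition mild_solution ::
  "(real^'d::finite) set \<Rightarrow> (nat \<Rightarrow> real) \<Rightarrow> (nat \<Rightarrow> real^'d \<Rightarrow> real) \<Rightarrow> real
     \<Rightarrow> ((real^'d \<Rightarrow> real) \<Rightarrow> real^'d \<Rightarrow> real) \<Rightarrow> (real^'d \<Rightarrow> real) \<Rightarrow> real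
     \<Rightarrow> (real \<Rightarrow> real^'d \<Rightarrow> real) \<Rightarrow> bool" where
  "mild_solution \<Omega> \<theta> \<phi> \<alpha> H u0 T u \<longleftrightarrow>
     (\<forall>t\<in>{0..T}. \<exists>q.
        has_L2_integral \<Omega> (lebesgue_on {0..t}) (\<lambda>\<tau>. R_op \<Omega> \<theta> \<phi> \<alpha> (t - \<tau>) (H (u \<tau>))) q \<and>
        L2_eq \<Omega> (u t) (\<lambda>x. S_op \<Omega> \<theta> \<phi> \<alpha> t u0 x + q x))"

end

theory Submission
  imports Defs
begin

text \<open>In the eigenbasis the difference \<open>w = v - u\<close> of two mild solutions solves scalar Volterra
  equations whose kernels are bounded by \<open>M (t - \<tau>)\<^bsup>\<alpha>-1\<^esup> / (1 + \<theta>\<^sub>k)\<close> with \<open>M\<close> independent of \<open>k\<close>.  The factor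
  \<open>1 / (1 + \<theta>\<^sub>k)\<close> absorbs the weight \<open>\<theta>\<^sub>k\<^bsup>1/2\<^esup>\<close> of the \<open>D\<^sup>1\<close> norm, and \<open>H\<close> is Lipschitz from \<open>D\<^sup>1(\<Omega>)\<close>
  to \<open>L\<^sup>2(\<Omega>)\<close>, because \<open>\<parallel>\<nabla>w\<parallel>\<^sup>2 = \<Sum>\<^sub>k \<theta>\<^sub>k \<langle>w,\<phi>\<^sub>k\<rangle>\<^sup>2\<close>.  Hence \<open>y(t) = \<parallel>w(t)\<parallel>\<close> in \<open>D\<^sup>1\<close> satisfies
  \<open>y(t) \<le> a + b \<integral>\<^sub>0\<^sup>t (t - \<tau>)\<^bsup>\<alpha>-1\<^esup> y(\<tau>) d\<tau>\<close> with \<open>a\<close> proportional to the \<open>D\<^sup>1\<close> distance of the initial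
  data, and a weakly singular Gronwall inequality gives uniqueness and stability.\<close>

section \<open>The Hilbert space \<open>L\<^sup>2(\<Omega>)\<close>\<close>

text \<open>\<open>L2_suminf\<close> and \<open>weak_partial\<close> are Hilbert choices, and so,
  through them, are both solution operators and \<open>convection\<close>. Nothing is known about a
  choice before a suitable object exists, which is why completeness of the space comes first; and it
  is fixed only up to null sets, so \<open>convection\<close> is not linear pointwise. The remedy is
  to work with coefficients \<open>L2_inner \<Omega> w (\<phi> k)\<close>, which do not see null
  sets and determine \<open>w\<close> up to them. Integrals enter the same way: pairing with
  \<open>\<phi> k\<close> turns the \<open>L2\<close>-valued integral into a Lebesgue integral over
  \<open>{0..t}\<close>. Estimates are made for the first n coefficients, where only finite
  Euclidean norms occur, with bounds independent of n; the D^1 norm follows by letting n grow. The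
  kernel bound M is the Mittag-Leffler series with all signs made positive, taken at
  \<open>T powr \<alpha>\<close>; hence it depends on \<open>T\<close>.\<close>

lemma L2_measurable: "f \<in> L2 \<Omega> \<Longrightarrow> f \<in> borel_measurable (lebesgue_on \<Omega>)"
  by (simp add: L2_def)

lemma L2_integrable_square: "f \<in> L2 \<Omega> \<Longrightarrow> integrable (lebesgue_on \<Omega>) (\<lambda>x. (f x)\<^sup>2)"
  by (simp add: L2_def)

lemma L2_integrable_mult:
  assumes "f \<in> L2 \<Omega>" "g \<in> L2 \<Omega>"
  shows "integrable (lebesgue_on \<Omega>) (\<lambda>x. f x * g x)"
proof (rule Bochner_Integration.integrable_bound)
  show "integrable (lebesgue_on \<Omega>) (\<lambda>x. (f x)\<^sup>2 + (g x)\<^sup>2)"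
    using assms by (intro Bochner_Integration.integrable_add L2_integrable_square)
  show "(\<lambda>x. f x * g x) \<in> borel_measurable (lebesgue_on \<Omega>)"
    using assms by (intro borel_measurable_times L2_measurable)
  have "\<bar>a\<bar> * \<bar>b\<bar> \<le> a\<^sup>2 + b\<^sup>2" for a b :: real
    using sum_squares_bound[of "\<bar>a\<bar>" "\<bar>b\<bar>"] mult_nonneg_nonneg[OF abs_ge_zero[of a] abs_ge_zero[of b]]
    unfolding power2_abs mult.assoc by linarith
  then show "AE x in lebesgue_on \<Omega>. norm (f x * g x) \<le> norm ((f x)\<^sup>2 + (g x)\<^sup>2)"
    by (intro AE_I2) (simp add: abs_mult)
qed

lemma L2_zero [simp]: "(\<lambda>x. 0) \<in> L2 \<Omega>"
  by (simp add: L2_def)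

lemma L2_scale: "f \<in> L2 \<Omega> \<Longrightarrow> (\<lambda>x. c * f x) \<in> L2 \<Omega>"
  by (auto simp: L2_def power_mult_distrib)

lemma L2_add:
  assumes "f \<in> L2 \<Omega>" "g \<in> L2 \<Omega>"
  shows "(\<lambda>x. f x + g x) \<in> L2 \<Omega>"
proof -
  have "integrable (lebesgue_on \<Omega>) (\<lambda>x. (f x)\<^sup>2 + (g x)\<^sup>2 + 2 * (f x * g x))"
    using assms
    by (intro Bochner_Integration.integrable_add integrable_mult_right L2_integrable_square L2_integrable_mult)
  then show ?thesis
    using assms by (auto simp: L2_def power2_sum mult.assoc)
qed

lemma L2_diff: "f \<in> L2 \<Omega> \<Longrightarrow> g \<in> L2 \<Omega> \<Longrightarrow> (\<lambda>x. f x - g x) \<in> L2 \<Omega>"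
  using L2_add[of f \<Omega> "\<lambda>x. -1 * g x"] L2_scale[of g \<Omega> "-1"] by simp

lemma L2_sum: "(\<And>i. i \<in> I \<Longrightarrow> f i \<in> L2 \<Omega>) \<Longrightarrow> (\<lambda>x. \<Sum>i\<in>I. f i x) \<in> L2 \<Omega>"
  by (induction I rule: infinite_finite_induct) (auto intro: L2_add)

lemma L2_inner_commute: "L2_inner \<Omega> f g = L2_inner \<Omega> g f"
  by (simp add: L2_inner_def mult.commute)

lemma L2_inner_add_left:
  "f \<in> L2 \<Omega> \<Longrightarrow> g \<in> L2 \<Omega> \<Longrightarrow> h \<in> L2 \<Omega> \<Longrightarrow>
   L2_inner \<Omega> (\<lambda>x. f x + g x) h = L2_inner \<Omega> f h + L2_inner \<Omega> g h"
  by (simp add: L2_inner_def distrib_right L2_integrable_mult)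

lemma L2_inner_diff_left:
  "f \<in> L2 \<Omega> \<Longrightarrow> g \<in> L2 \<Omega> \<Longrightarrow> h \<in> L2 \<Omega> \<Longrightarrow>
   L2_inner \<Omega> (\<lambda>x. f x - g x) h = L2_inner \<Omega> f h - L2_inner \<Omega> g h"
  by (simp add: L2_inner_def left_diff_distrib L2_integrable_mult)

lemma L2_inner_scale_left [simp]: "L2_inner \<Omega> (\<lambda>x. c * f x) g = c * L2_inner \<Omega> f g"
  by (simp add: L2_inner_def mult.assoc)

lemma L2_inner_scale_right [simp]: "L2_inner \<Omega> g (\<lambda>x. c * f x) = c * L2_inner \<Omega> g f"
  by (metis L2_inner_commute L2_inner_scale_left)

lemma L2_inner_zero [simp]: "L2_inner \<Omega> (\<lambda>x. 0) g = 0" "L2_inner \<Omega> g (\<lambda>x. 0) = 0"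
  by (simp_all add: L2_inner_def)

lemma L2_inner_sum_left:
  "(\<And>i. i \<in> I \<Longrightarrow> f i \<in> L2 \<Omega>) \<Longrightarrow> h \<in> L2 \<Omega> \<Longrightarrow>
   L2_inner \<Omega> (\<lambda>x. \<Sum>i\<in>I. f i x) h = (\<Sum>i\<in>I. L2_inner \<Omega> (f i) h)"
  by (induction I rule: infinite_finite_induct) (auto simp: L2_inner_add_left L2_sum)

lemma L2_inner_sum_right:
  "(\<And>i. i \<in> I \<Longrightarrow> f i \<in> L2 \<Omega>) \<Longrightarrow> h \<in> L2 \<Omega> \<Longrightarrow>
   L2_inner \<Omega> h (\<lambda>x. \<Sum>i\<in>I. f i x) = (\<Sum>i\<in>I. L2_inner \<Omega> h (f i))"
  using L2_inner_sum_left[of I f \<Omega> h] by (simp add: L2_inner_commute)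

lemma L2_inner_cong_AE:
  assumes "L2_eq \<Omega> f g" "f \<in> L2 \<Omega>" "g \<in> L2 \<Omega>" "h \<in> L2 \<Omega>"
  shows "L2_inner \<Omega> f h = L2_inner \<Omega> g h"
  unfolding L2_inner_def
proof (rule integral_cong_AE)
  show "AE x in lebesgue_on \<Omega>. f x * h x = g x * h x"
    using assms(1) unfolding L2_eq_def by eventually_elim simp
qed (use assms in \<open>auto intro!: borel_measurable_times dest: L2_measurable\<close>)

lemma L2_inner_self_nonneg: "0 \<le> L2_inner \<Omega> f f"
  by (simp add: L2_inner_def)

lemma L2_norm_nonneg [simp]: "0 \<le> L2_norm \<Omega> f"
  by (simp add: L2_norm_def L2_inner_self_nonneg)

lemma L2_norm_power2: "(L2_norm \<Omega> f)\<^sup>2 = L2_inner \<Omega> f f"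
  by (simp add: L2_norm_def L2_inner_self_nonneg)

lemma L2_norm_scale [simp]: "L2_norm \<Omega> (\<lambda>x. c * f x) = \<bar>c\<bar> * L2_norm \<Omega> f"
  by (simp add: L2_norm_def real_sqrt_mult mult.assoc[symmetric])

lemma L2_norm_minus_commute: "L2_norm \<Omega> (\<lambda>x. f x - g x) = L2_norm \<Omega> (\<lambda>x. g x - f x)"
  using L2_norm_scale[of \<Omega> "-1" "\<lambda>x. g x - f x"] by simp

lemma L2_norm_zero [simp]: "L2_norm \<Omega> (\<lambda>x. 0) = 0"
  by (simp add: L2_norm_def)

lemma L2_inner_add_self:
  assumes "f \<in> L2 \<Omega>" "g \<in> L2 \<Omega>"
  shows "L2_inner \<Omega> (\<lambda>x. f x + g x) (\<lambda>x. f x + g x)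
           = L2_inner \<Omega> f f + 2 * L2_inner \<Omega> f g + L2_inner \<Omega> g g"
proof -
  have "L2_inner \<Omega> h (\<lambda>x. f x + g x) = L2_inner \<Omega> f h + L2_inner \<Omega> g h" if "h \<in> L2 \<Omega>" for h
    using that assms by (subst L2_inner_commute) (rule L2_inner_add_left)
  with assms show ?thesis
    by (simp add: L2_inner_add_left L2_add)
      (metis L2_inner_commute)
qed

text \<open>Nonnegativity of the quadratic form (s,r) -> ||s f + r g||^2 gives the discriminant
  inequality. A function of norm 0 need not be the zero function, so this case is treated
  separately.\<close>

lemma L2_Cauchy_Schwarz:
  assumes "f \<in> L2 \<Omega>" "g \<in> L2 \<Omega>"
  shows "\<bar>L2_inner \<Omega> f g\<bar> \<le> L2_norm \<Omega> f * L2_norm \<Omega> g"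
proof -
  let ?a = "L2_inner \<Omega> f f" and ?b = "L2_inner \<Omega> f g" and ?c = "L2_inner \<Omega> g g"
  have pos: "0 \<le> ?a * s\<^sup>2 + 2 * ?b * s * r + ?c * r\<^sup>2" for s r
  proof -
    have "0 \<le> L2_inner \<Omega> (\<lambda>x. s * f x + r * g x) (\<lambda>x. s * f x + r * g x)"
      by (rule L2_inner_self_nonneg)
    also have "\<dots> = ?a * s\<^sup>2 + 2 * ?b * s * r + ?c * r\<^sup>2"
      using assms by (subst L2_inner_add_self) (auto simp: L2_scale power2_eq_square algebra_simps)
    finally show ?thesis .
  qed
  have "?b\<^sup>2 \<le> ?a * ?c"
  proof (cases "?c = 0")
    case True
    \<comment> \<open>With \<open>?c = 0\<close> and \<open>s = 1\<close> the form is affine in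
      \<open>r\<close>; this \<open>r\<close> turns its value into -1, so \<open>?b\<close> must
      vanish.\<close>
    have "0 \<le> ?a - 2 * ?b * ((?a + 1) * ?b / (2 * ?b\<^sup>2))" if "?b \<noteq> 0"
      using pos[of 1 "- ((?a + 1) * ?b / (2 * ?b\<^sup>2))"] True by simp
    then have "?b = 0"
      by (auto simp: power2_eq_square field_simps)
    then show ?thesis using True by simp
  next
    case False
    then have c: "?c > 0" using L2_inner_self_nonneg[of \<Omega> g] by simp
    have "0 \<le> ?c * (?a * ?c - ?b\<^sup>2)"
      using pos[of "?c" "- ?b"] by (simp add: power2_eq_square algebra_simps)
    then show ?thesis using c by (simp add: zero_le_mult_iff)
  qed
  then have "sqrt (?b\<^sup>2) \<le> sqrt (?a * ?c)" by (rule real_sqrt_le_mono)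
  then show ?thesis by (simp add: L2_norm_def real_sqrt_mult)
qed

lemma L2_norm_triangle:
  assumes "f \<in> L2 \<Omega>" "g \<in> L2 \<Omega>"
  shows "L2_norm \<Omega> (\<lambda>x. f x + g x) \<le> L2_norm \<Omega> f + L2_norm \<Omega> g"
proof (rule power2_le_imp_le)
  show "(L2_norm \<Omega> (\<lambda>x. f x + g x))\<^sup>2 \<le> (L2_norm \<Omega> f + L2_norm \<Omega> g)\<^sup>2"
    using L2_Cauchy_Schwarz[OF assms] assms
    by (simp add: L2_norm_power2 L2_inner_add_self power2_sum)
qed simp

lemma L2_norm_sum_le:
  "(\<And>i. i \<in> I \<Longrightarrow> f i \<in> L2 \<Omega>) \<Longrightarrow> L2_norm \<Omega> (\<lambda>x. \<Sum>i\<in>I. f i x) \<le> (\<Sum>i\<in>I. L2_norm \<Omega> (f i))"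
proof (induction I rule: infinite_finite_induct)
  case (insert i I)
  have "L2_norm \<Omega> (\<lambda>x. f i x + (\<Sum>i\<in>I. f i x)) \<le> L2_norm \<Omega> (f i) + L2_norm \<Omega> (\<lambda>x. \<Sum>i\<in>I. f i x)"
    by (intro L2_norm_triangle L2_sum) (use insert in auto)
  with insert show ?case by fastforce
qed auto

lemma L2_norm_cong_AE:
  assumes "L2_eq \<Omega> f g" "f \<in> L2 \<Omega>" "g \<in> L2 \<Omega>"
  shows "L2_norm \<Omega> f = L2_norm \<Omega> g"
  using L2_inner_cong_AE[OF assms assms(2)] L2_inner_cong_AE[OF assms assms(3)]
  by (metis L2_norm_def L2_inner_commute)

lemma L2_tendsto_inner:
  assumes "L2_tendsto \<Omega> f g" "h \<in> L2 \<Omega>"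
  shows "(\<lambda>n. L2_inner \<Omega> (f n) h) \<longlonglongrightarrow> L2_inner \<Omega> g h"
proof (rule LIM_zero_cancel, rule Lim_null_comparison)
  have fg: "\<And>n. f n \<in> L2 \<Omega>" "g \<in> L2 \<Omega>" using assms by (auto simp: L2_tendsto_def)
  show "\<forall>\<^sub>F n in sequentially. norm (L2_inner \<Omega> (f n) h - L2_inner \<Omega> g h)
           \<le> L2_norm \<Omega> (\<lambda>x. f n x - g x) * L2_norm \<Omega> h"
    using L2_Cauchy_Schwarz[OF L2_diff[OF fg] assms(2)] fg assms(2)
    by (auto simp: L2_inner_diff_left)
  show "(\<lambda>n. L2_norm \<Omega> (\<lambda>x. f n x - g x) * L2_norm \<Omega> h) \<longlonglongrightarrow> 0"
    using assms(1) by (auto simp: L2_tendsto_def intro: tendsto_mult_left_zero)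
qed

lemma L2_tendsto_norm:
  assumes "L2_tendsto \<Omega> f g"
  shows "(\<lambda>n. L2_norm \<Omega> (f n)) \<longlonglongrightarrow> L2_norm \<Omega> g"
proof (rule LIM_zero_cancel, rule Lim_null_comparison)
  have fg: "\<And>n. f n \<in> L2 \<Omega>" "g \<in> L2 \<Omega>" using assms by (auto simp: L2_tendsto_def)
  have "\<bar>L2_norm \<Omega> (f n) - L2_norm \<Omega> g\<bar> \<le> L2_norm \<Omega> (\<lambda>x. f n x - g x)" for n
    using L2_norm_triangle[OF L2_diff[OF fg, of n] fg(2)]
      L2_norm_triangle[OF L2_diff[OF fg(2) fg(1), of n] fg(1)[of n]]
    by (simp add: L2_norm_minus_commute[of \<Omega> g])
  then show "\<forall>\<^sub>F n in sequentially. norm (L2_norm \<Omega> (f n) - L2_norm \<Omega> g) \<le> L2_norm \<Omega> (\<lambda>x. f n x - g x)"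
    by simp
  show "(\<lambda>n. L2_norm \<Omega> (\<lambda>x. f n x - g x)) \<longlonglongrightarrow> 0"
    using assms by (simp add: L2_tendsto_def)
qed

lemma L2_inner_self_eq_nn_integral:
  assumes "f \<in> L2 \<Omega>"
  shows "(\<integral>\<^sup>+x. ennreal ((f x)\<^sup>2) \<partial>lebesgue_on \<Omega>) = ennreal ((L2_norm \<Omega> f)\<^sup>2)"
  using nn_integral_eq_integral[OF L2_integrable_square[OF assms]]
  by (simp add: L2_norm_power2) (simp add: L2_inner_def power2_eq_square)

text \<open>Cauchy-Schwarz against the constant 1, which is square-integrable as \<Omega> has finite
  measure. It makes fast decaying \<open>L2\<close> increments summable in L^1.\<close>

lemma nn_integral_abs_le_L2_norm:
  assumes "f \<in> L2 \<Omega>" "\<Omega> \<in> lmeasurable"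
  shows "(\<integral>\<^sup>+x. ennreal \<bar>f x\<bar> \<partial>lebesgue_on \<Omega>) \<le> ennreal (L2_norm \<Omega> f * L2_norm \<Omega> (\<lambda>x. 1))"
proof -
  interpret finite_measure "lebesgue_on \<Omega>"
    using assms(2) by (rule finite_measure_lebesgue_on)
  have one: "(\<lambda>x. 1) \<in> L2 \<Omega>" by (simp add: L2_def)
  have abs: "(\<lambda>x. \<bar>f x\<bar>) \<in> L2 \<Omega>" using assms(1) by (auto simp: L2_def)
  have "integrable (lebesgue_on \<Omega>) (\<lambda>x. \<bar>f x\<bar>)"
    using L2_integrable_mult[OF abs one] by simp
  then have "(\<integral>\<^sup>+x. ennreal \<bar>f x\<bar> \<partial>lebesgue_on \<Omega>) = ennreal (L2_inner \<Omega> (\<lambda>x. \<bar>f x\<bar>) (\<lambda>x. 1))"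
    by (simp add: nn_integral_eq_integral L2_inner_def)
  also have "L2_inner \<Omega> (\<lambda>x. \<bar>f x\<bar>) (\<lambda>x. 1) \<le> L2_norm \<Omega> (\<lambda>x. \<bar>f x\<bar>) * L2_norm \<Omega> (\<lambda>x. 1)"
    using L2_Cauchy_Schwarz[OF abs one] by linarith
  also have "L2_norm \<Omega> (\<lambda>x. \<bar>f x\<bar>) = L2_norm \<Omega> f"
    by (simp add: L2_norm_def L2_inner_def)
  finally show ?thesis by (simp add: ennreal_leI)
qed

text \<open>Riesz-Fischer. A subsequence with increments below \<open>(1/2) ^ k\<close> has
  integrable total variation, hence converges almost everywhere; Fatou's lemma turns the Cauchy
  bounds into bounds on the distance to that limit.\<close>

lemma L2_complete:
  assumes \<Omega>: "\<Omega> \<in> lmeasurable" and f: "\<And>n. f n \<in> L2 \<Omega>"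
    and Cauchy: "\<And>e. e > 0 \<Longrightarrow> \<exists>N. \<forall>m\<ge>N. \<forall>n\<ge>N. L2_norm \<Omega> (\<lambda>x. f m x - f n x) < e"
  obtains g where "L2_tendsto \<Omega> f g"
proof -
  let ?M = "lebesgue_on \<Omega>"
  have meas[measurable]: "f n \<in> borel_measurable ?M" for n
    using f by (rule L2_measurable)
  have "\<exists>N. \<forall>m\<ge>N. \<forall>n\<ge>N. L2_norm \<Omega> (\<lambda>x. f m x - f n x) < (1/2) ^ k" for k
    by (rule Cauchy) simp
  then obtain N where N: "\<And>k m n. m \<ge> N k \<Longrightarrow> n \<ge> N k \<Longrightarrow> L2_norm \<Omega> (\<lambda>x. f m x - f n x) < (1/2) ^ k"
    by metis
  \<comment> \<open>Partial sums of \<open>N\<close> are monotone and dominate \<open>N k\<close>,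
    so all differences from index \<open>k\<close> on fall under the bound for
    \<open>k\<close>.\<close>
  define r where "r k = (\<Sum>i\<le>k. N i) + k" for k
  have r_ge: "r k \<ge> N k" "r k \<ge> k" "r k \<le> r (Suc k)" for k
    by (auto simp: r_def intro: trans_le_add1 member_le_sum)
  have r_mono: "r k \<le> r l" if "k \<le> l" for k l
    using that r_ge(3) by (rule lift_Suc_mono_le[of r, rotated])
  have d: "(\<lambda>x. f (r (Suc k)) x - f (r k) x) \<in> L2 \<Omega>" for k
    using f by (intro L2_diff)
  have d_le: "L2_norm \<Omega> (\<lambda>x. f (r (Suc k)) x - f (r k) x) \<le> (1/2) ^ k" for k
    using N[of k "r (Suc k)" "r k"] r_ge[of k] by simp
  have "(\<integral>\<^sup>+x. (\<Sum>k. ennreal \<bar>f (r (Suc k)) x - f (r k) x\<bar>) \<partial>?M)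
      = (\<Sum>k. \<integral>\<^sup>+x. ennreal \<bar>f (r (Suc k)) x - f (r k) x\<bar> \<partial>?M)"
    by (intro nn_integral_suminf) measurable
  also have "\<dots> \<le> (\<Sum>k. ennreal ((1/2) ^ k * L2_norm \<Omega> (\<lambda>x. 1)))"
  proof (intro suminf_le)
    show "(\<integral>\<^sup>+x. ennreal \<bar>f (r (Suc k)) x - f (r k) x\<bar> \<partial>?M) \<le> ennreal ((1/2) ^ k * L2_norm \<Omega> (\<lambda>x. 1))" for k
      using d_le by (intro order.trans[OF nn_integral_abs_le_L2_norm[OF d \<Omega>]] ennreal_leI mult_right_mono) auto
  qed auto
  also have "\<dots> < \<infinity>"
  proof -
    have "summable (\<lambda>k. (1/2) ^ k * L2_norm \<Omega> (\<lambda>x. 1))"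
      by (intro summable_mult2 summable_geometric) simp
    then show ?thesis
      by (subst suminf_ennreal2) (auto simp: less_top[symmetric])
  qed
  finally have "(\<integral>\<^sup>+x. (\<Sum>k. ennreal \<bar>f (r (Suc k)) x - f (r k) x\<bar>) \<partial>?M) \<noteq> \<infinity>" by simp
  then have "AE x in ?M. (\<Sum>k. ennreal \<bar>f (r (Suc k)) x - f (r k) x\<bar>) \<noteq> \<infinity>"
    by (rule nn_integral_PInf_AE[rotated]) measurable
  then have AE_conv: "AE x in ?M. convergent (\<lambda>k. f (r k) x)"
  proof eventually_elim
    case (elim x)
    have "summable (\<lambda>k. \<bar>f (r (Suc k)) x - f (r k) x\<bar>)"
      using elim by (intro summable_suminf_not_top) auto
    then have "summable (\<lambda>k. f (r (Suc k)) x - f (r k) x)"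
      by (rule summable_rabs_cancel)
    then have "convergent (\<lambda>n. \<Sum>k<n. f (r (Suc k)) x - f (r k) x)"
      by (simp add: summable_iff_convergent)
    then have "convergent (\<lambda>n. f (r n) x - f (r 0) x)"
      by (simp add: sum_lessThan_telescope[of "\<lambda>k. f (r k) x"])
    then have "convergent (\<lambda>n. (f (r n) x - f (r 0) x) + f (r 0) x)"
      by (intro convergent_add) (auto simp: convergent_const)
    then show ?case by simp
  qed
  define g where "g x = lim (\<lambda>k. f (r k) x)" for x
  have g_meas[measurable]: "g \<in> borel_measurable ?M"
    unfolding g_def by measurable
  have AE_lim: "AE x in ?M. (\<lambda>k. f (r k) x) \<longlonglongrightarrow> g x"
    using AE_conv by eventually_elim (simp add: g_def convergent_LIMSEQ_iff)
  \<comment> \<open>One estimate for two purposes: its finiteness puts \<open>f n - g\<close> in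
    \<open>L2\<close>, its value gives the convergence.\<close>
  have Fatou: "(\<integral>\<^sup>+x. ennreal ((f n x - g x)\<^sup>2) \<partial>?M) \<le> ennreal (((1/2) ^ k)\<^sup>2)" if n: "n \<ge> N k" for n k
  proof -
    have "(\<integral>\<^sup>+x. ennreal ((f n x - g x)\<^sup>2) \<partial>?M)
        = (\<integral>\<^sup>+x. liminf (\<lambda>l. ennreal ((f n x - f (r l) x)\<^sup>2)) \<partial>?M)"
    proof (rule nn_integral_cong_AE)
      show "AE x in ?M. ennreal ((f n x - g x)\<^sup>2) = liminf (\<lambda>l. ennreal ((f n x - f (r l) x)\<^sup>2))"
        using AE_lim
      proof eventually_elim
        case (elim x)
        then have "(\<lambda>l. ennreal ((f n x - f (r l) x)\<^sup>2)) \<longlonglongrightarrow> ennreal ((f n x - g x)\<^sup>2)"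
          by (intro tendsto_intros) auto
        then show ?case
          by (intro lim_imp_Liminf[symmetric]) auto
      qed
    qed
    also have "\<dots> \<le> liminf (\<lambda>l. \<integral>\<^sup>+x. ennreal ((f n x - f (r l) x)\<^sup>2) \<partial>?M)"
      by (intro nn_integral_liminf) measurable
    also have "\<dots> \<le> liminf (\<lambda>l. ennreal (((1/2) ^ k)\<^sup>2))"
    proof (intro Liminf_mono eventually_mono[OF eventually_ge_at_top[of k]])
      fix l assume "k \<le> l"
      then have "r l \<ge> N k" using r_mono[of k l] r_ge(1)[of k] by linarith
      then have "L2_norm \<Omega> (\<lambda>x. f n x - f (r l) x) < (1/2) ^ k" using n by (intro N)
      then show "(\<integral>\<^sup>+x. ennreal ((f n x - f (r l) x)\<^sup>2) \<partial>?M) \<le> ennreal (((1/2) ^ k)\<^sup>2)"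
        using f by (subst L2_inner_self_eq_nn_integral) (auto intro!: L2_diff ennreal_leI power_mono)
    qed
    also have "\<dots> = ennreal (((1/2) ^ k)\<^sup>2)" by (simp add: Liminf_const)
    finally show ?thesis .
  qed
  have diff: "(\<lambda>x. f n x - g x) \<in> L2 \<Omega>" if "n \<ge> N k" for n k
  proof -
    have "integrable ?M (\<lambda>x. (f n x - g x)\<^sup>2)"
      using Fatou[OF that] by (intro integrableI_nonneg) (auto intro: order.strict_trans1)
    then show ?thesis by (simp add: L2_def)
  qed
  have g: "g \<in> L2 \<Omega>"
    using L2_diff[OF f[of "N 0"] diff[of 0 "N 0"]] by simp
  have "(\<lambda>n. L2_norm \<Omega> (\<lambda>x. f n x - g x)) \<longlonglongrightarrow> 0"
  proof (rule LIMSEQ_I)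
    fix e :: real assume "e > 0"
    then obtain k where k: "(1/2) ^ k < e"
      using real_arch_pow_inv[of e "1/2"] by auto
    have "norm (L2_norm \<Omega> (\<lambda>x. f n x - g x) - 0) < e" if n: "n \<ge> N k" for n
    proof -
      have "ennreal ((L2_norm \<Omega> (\<lambda>x. f n x - g x))\<^sup>2) \<le> ennreal (((1/2) ^ k)\<^sup>2)"
        using Fatou[OF n] L2_inner_self_eq_nn_integral[OF diff[OF n]] by simp
      then have "(L2_norm \<Omega> (\<lambda>x. f n x - g x))\<^sup>2 \<le> ((1/2) ^ k)\<^sup>2"
        by (simp add: ennreal_le_iff)
      then have "L2_norm \<Omega> (\<lambda>x. f n x - g x) \<le> (1/2) ^ k"
        by (rule power2_le_imp_le) simp
      with k show ?thesis by simp
    qed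
    then show "\<exists>no. \<forall>n\<ge>no. norm (L2_norm \<Omega> (\<lambda>x. f n x - g x) - 0) < e" by blast
  qed
  then have "L2_tendsto \<Omega> f g" using f g by (simp add: L2_tendsto_def)
  then show ?thesis by (rule that)
qed

section \<open>Orthonormal expansions\<close>

locale L2_orthonormal =
  fixes \<Omega> :: "(real^'d::finite) set" and \<phi> :: "nat \<Rightarrow> real^'d \<Rightarrow> real"
  assumes lmeasurable: "\<Omega> \<in> lmeasurable"
    and basis_L2: "\<phi> k \<in> L2 \<Omega>"
    and orthonormal: "L2_inner \<Omega> (\<phi> j) (\<phi> k) = (if j = k then 1 else 0)"
begin

lemma combination_L2: "(\<lambda>x. \<Sum>k\<in>K. c k * \<phi> k x) \<in> L2 \<Omega>"
  by (intro L2_sum L2_scale basis_L2)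

lemma inner_combination:
  "finite K \<Longrightarrow> L2_inner \<Omega> (\<lambda>x. \<Sum>k\<in>K. c k * \<phi> k x) (\<phi> j) = (if j \<in> K then c j else 0)"
  by (simp add: L2_inner_sum_left L2_scale basis_L2 orthonormal if_distrib cong: if_cong)

lemma norm_combination:
  assumes "finite K"
  shows "(L2_norm \<Omega> (\<lambda>x. \<Sum>k\<in>K. c k * \<phi> k x))\<^sup>2 = (\<Sum>k\<in>K. (c k)\<^sup>2)"
proof -
  have "L2_inner \<Omega> (\<lambda>x. \<Sum>k\<in>K. c k * \<phi> k x) (\<lambda>x. \<Sum>j\<in>K. c j * \<phi> j x)
      = (\<Sum>j\<in>K. c j * L2_inner \<Omega> (\<lambda>x. \<Sum>k\<in>K. c k * \<phi> k x) (\<phi> j))"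
    by (subst L2_inner_sum_right) (auto intro: L2_scale basis_L2 combination_L2)
  also have "\<dots> = (\<Sum>k\<in>K. (c k)\<^sup>2)"
    using assms by (intro sum.cong) (auto simp: inner_combination power2_eq_square)
  finally show ?thesis by (simp add: L2_norm_power2)
qed

text \<open>The partial sum \<open>s\<close> satisfies ||s||^2 = <w,s>, as both equal the sum of
  squared coefficients; Cauchy-Schwarz and division by ||s|| finish.\<close>

lemma Bessel:
  assumes "w \<in> L2 \<Omega>"
  shows "(\<Sum>k<n. (L2_inner \<Omega> w (\<phi> k))\<^sup>2) \<le> (L2_norm \<Omega> w)\<^sup>2"
proof -
  define s where "s x = (\<Sum>k<n. L2_inner \<Omega> w (\<phi> k) * \<phi> k x)" for x
  have s: "s \<in> L2 \<Omega>" unfolding s_def by (rule combination_L2)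
  have norm_s: "(L2_norm \<Omega> s)\<^sup>2 = (\<Sum>k<n. (L2_inner \<Omega> w (\<phi> k))\<^sup>2)"
    unfolding s_def by (intro norm_combination) simp
  have "L2_inner \<Omega> w s = (\<Sum>k<n. L2_inner \<Omega> w (\<phi> k) * L2_inner \<Omega> w (\<phi> k))"
    unfolding s_def using assms by (subst L2_inner_sum_right) (auto intro: L2_scale basis_L2)
  then have "(L2_norm \<Omega> s)\<^sup>2 = L2_inner \<Omega> w s"
    unfolding norm_s by (simp add: power2_eq_square)
  also have "\<dots> \<le> L2_norm \<Omega> w * L2_norm \<Omega> s"
    using L2_Cauchy_Schwarz[OF assms s] by linarith
  finally have "L2_norm \<Omega> s \<le> L2_norm \<Omega> w"
    using L2_norm_nonneg[of \<Omega> s] by (cases "L2_norm \<Omega> s = 0") (auto simp: power2_eq_square)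
  then show ?thesis unfolding norm_s[symmetric] by (intro power_mono) auto
qed

lemma summable_coefficients: "w \<in> L2 \<Omega> \<Longrightarrow> summable (\<lambda>k. (L2_inner \<Omega> w (\<phi> k))\<^sup>2)"
  by (rule bounded_imp_summable[where B = "(L2_norm \<Omega> w)\<^sup>2"])
    (use Bessel[of w "Suc _"] in \<open>auto simp: lessThan_Suc_atMost\<close>)

text \<open>The choice in \<open>L2_suminf\<close> has properties only once some limit exists.
  Orthonormality makes the distance of partial sums the root of a block of the square sum, and
  completeness gives the limit.\<close>

lemma L2_suminf_tendsto:
  assumes "summable (\<lambda>k. (c k)\<^sup>2)"
  shows "L2_tendsto \<Omega> (\<lambda>n x. \<Sum>k<n. c k * \<phi> k x) (L2_suminf \<Omega> (\<lambda>k x. c k * \<phi> k x))"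
proof -
  let ?s = "\<lambda>n x. \<Sum>k<n. c k * \<phi> k x"
  have ord: "L2_norm \<Omega> (\<lambda>x. ?s m x - ?s n x) = sqrt (\<Sum>k=n..<m. (c k)\<^sup>2)" if "n \<le> m" for m n
  proof -
    have "?s m x - ?s n x = (\<Sum>k\<in>{n..<m}. c k * \<phi> k x)" for x
      using that by (simp add: sum_diff_nat_ivl lessThan_atLeast0)
    then show ?thesis
      using norm_combination[of "{n..<m}" c] by (simp add: real_sqrt_unique)
  qed
  have "\<exists>N. \<forall>m\<ge>N. \<forall>n\<ge>N. L2_norm \<Omega> (\<lambda>x. ?s m x - ?s n x) < e" if e: "e > 0" for e
  proof -
    have "e\<^sup>2 > 0" using e by simp
    then obtain N where N: "\<And>m n. n \<ge> N \<Longrightarrow> norm (\<Sum>k=n..<m. (c k)\<^sup>2) < e\<^sup>2"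
      using assms unfolding summable_Cauchy by blast
    have le: "L2_norm \<Omega> (\<lambda>x. ?s m x - ?s n x) < e" if "n \<le> m" "N \<le> n" for m n
    proof -
      have "(\<Sum>k=n..<m. (c k)\<^sup>2) < e\<^sup>2" using N[OF that(2), of m] by (simp add: sum_nonneg)
      then show ?thesis
        using e unfolding ord[OF that(1)] by (metis real_sqrt_less_mono real_sqrt_unique less_imp_le)
    qed
    have "L2_norm \<Omega> (\<lambda>x. ?s m x - ?s n x) < e" if "m \<ge> N" "n \<ge> N" for m n
      using le[of n m] le[of m n] that L2_norm_minus_commute[of \<Omega> "?s m" "?s n"]
      by (cases "n \<le> m") auto
    then show ?thesis by blast
  qed
  then obtain g where "L2_tendsto \<Omega> ?s g"
    using L2_complete[of \<Omega> ?s, OF lmeasurable combination_L2] by blast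
  then show ?thesis unfolding L2_suminf_def by (rule someI[where P = "L2_tendsto \<Omega> ?s"])
qed

lemma L2_suminf_coefficient:
  assumes "summable (\<lambda>k. (c k)\<^sup>2)"
  shows "L2_suminf \<Omega> (\<lambda>k x. c k * \<phi> k x) \<in> L2 \<Omega>"
    and "L2_inner \<Omega> (L2_suminf \<Omega> (\<lambda>k x. c k * \<phi> k x)) (\<phi> j) = c j"
proof -
  note conv = L2_suminf_tendsto[OF assms]
  show "L2_suminf \<Omega> (\<lambda>k x. c k * \<phi> k x) \<in> L2 \<Omega>"
    using conv by (simp add: L2_tendsto_def)
  \<comment> \<open>From \<open>n = j + 1\<close> on the coefficient of the partial sum is exactly
    \<open>c j\<close>.\<close>
  have "\<forall>\<^sub>F n in sequentially. L2_inner \<Omega> (\<lambda>x. \<Sum>k<n. c k * \<phi> k x) (\<phi> j) = c j"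
    using eventually_gt_at_top[of j] by eventually_elim (simp add: inner_combination)
  then have "(\<lambda>n. L2_inner \<Omega> (\<lambda>x. \<Sum>k<n. c k * \<phi> k x) (\<phi> j)) \<longlonglongrightarrow> c j"
    by (rule tendsto_eventually)
  then show "L2_inner \<Omega> (L2_suminf \<Omega> (\<lambda>k x. c k * \<phi> k x)) (\<phi> j) = c j"
    using LIMSEQ_unique L2_tendsto_inner[OF conv basis_L2[of j]] by blast
qed

end

locale L2_orthonormal_basis = L2_orthonormal +
  assumes complete: "w \<in> L2 \<Omega> \<Longrightarrow> (\<And>k. L2_inner \<Omega> w (\<phi> k) = 0) \<Longrightarrow> L2_eq \<Omega> w (\<lambda>x. 0)"
begin

lemma L2_eqI:
  assumes "v \<in> L2 \<Omega>" "w \<in> L2 \<Omega>" "\<And>k. L2_inner \<Omega> v (\<phi> k) = L2_inner \<Omega> w (\<phi> k)"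
  shows "L2_eq \<Omega> v w"
proof -
  have "L2_eq \<Omega> (\<lambda>x. v x - w x) (\<lambda>x. 0)"
    using assms by (intro complete L2_diff) (simp_all add: L2_inner_diff_left basis_L2)
  then show ?thesis by (simp add: L2_eq_def)
qed

text \<open>The chosen sum has the coefficients of \<open>w\<close>, so completeness of the system
  identifies the two up to a null set, which the norms do not see.\<close>

lemma expansion_tendsto:
  assumes w: "w \<in> L2 \<Omega>"
  shows "L2_tendsto \<Omega> (\<lambda>n x. \<Sum>k<n. L2_inner \<Omega> w (\<phi> k) * \<phi> k x) w"
proof -
  let ?g = "L2_suminf \<Omega> (\<lambda>k x. L2_inner \<Omega> w (\<phi> k) * \<phi> k x)"
  note sm = summable_coefficients[OF w]
  note conv = L2_suminf_tendsto[OF sm]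
  note g = L2_suminf_coefficient[OF sm]
  have "L2_eq \<Omega> ?g w" using g w by (intro L2_eqI) auto
  then have "L2_eq \<Omega> (\<lambda>x. (\<Sum>k<n. L2_inner \<Omega> w (\<phi> k) * \<phi> k x) - ?g x)
                    (\<lambda>x. (\<Sum>k<n. L2_inner \<Omega> w (\<phi> k) * \<phi> k x) - w x)" for n
    by (auto simp: L2_eq_def)
  then have "L2_norm \<Omega> (\<lambda>x. (\<Sum>k<n. L2_inner \<Omega> w (\<phi> k) * \<phi> k x) - ?g x)
           = L2_norm \<Omega> (\<lambda>x. (\<Sum>k<n. L2_inner \<Omega> w (\<phi> k) * \<phi> k x) - w x)" for n
    using g(1) w by (intro L2_norm_cong_AE L2_diff combination_L2)
  then show ?thesis using conv w by (simp add: L2_tendsto_def)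
qed

end

section \<open>Weak derivatives\<close>

lemma test_fun_C_k: "\<psi> \<in> test_fun \<Omega> \<Longrightarrow> C_k k \<psi>"
  by (simp add: test_fun_def)

lemma bounded_continuous_L2:
  fixes f :: "real^'d::finite \<Rightarrow> real"
  assumes "\<Omega> \<in> sets lebesgue" "bounded \<Omega>" "continuous_on UNIV f"
  shows "f \<in> L2 \<Omega>"
proof -
  have "continuous_on (closure \<Omega>) (\<lambda>x. (f x)\<^sup>2)"
    by (intro continuous_intros continuous_on_subset[OF assms(3)]) auto
  then have "bounded ((\<lambda>x. (f x)\<^sup>2) ` closure \<Omega>)"
    using assms(2) by (intro compact_imp_bounded compact_continuous_image) auto
  then obtain B where B: "\<And>x. x \<in> \<Omega> \<Longrightarrow> norm ((f x)\<^sup>2) \<le> B"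
    unfolding bounded_iff using closure_subset by blast
  interpret finite_measure "lebesgue_on \<Omega>"
    using assms(1,2) by (intro finite_measure_lebesgue_on bounded_set_imp_lmeasurable)
  have meas: "f \<in> borel_measurable (lebesgue_on \<Omega>)"
    using continuous_on_subset[OF assms(3)] assms(1)
    by (intro continuous_imp_measurable_on_sets_lebesgue) auto
  then have "integrable (lebesgue_on \<Omega>) (\<lambda>x. (f x)\<^sup>2)"
    using B by (intro integrable_const_bound[where B = B]) auto
  with meas show ?thesis by (simp add: L2_def)
qed

lemma test_fun_partial_deriv_L2:
  assumes "\<Omega> \<in> sets lebesgue" "bounded \<Omega>" "\<psi> \<in> test_fun \<Omega>"
  shows "partial_deriv j \<psi> \<in> L2 \<Omega>"
  using test_fun_C_k[OF assms(3), of "Suc 0"] assms(1,2)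
  by (intro bounded_continuous_L2) auto

lemma test_fun_L2:
  assumes "\<Omega> \<in> sets lebesgue" "bounded \<Omega>" "\<psi> \<in> test_fun \<Omega>"
  shows "\<psi> \<in> L2 \<Omega>"
  using test_fun_C_k[OF assms(3), of 0] assms(1,2)
  by (intro bounded_continuous_L2) auto

lemma has_weak_partial_L2: "has_weak_partial \<Omega> j w g \<Longrightarrow> g \<in> L2 \<Omega>"
  by (simp add: has_weak_partial_def)

lemma has_weak_partial_weak_partial:
  "has_weak_partial \<Omega> j w g \<Longrightarrow> has_weak_partial \<Omega> j w (weak_partial \<Omega> j w)"
  unfolding weak_partial_def by (rule someI[of "has_weak_partial \<Omega> j w"])

lemma has_weak_partial_diff:
  assumes \<Omega>: "\<Omega> \<in> sets lebesgue" "bounded \<Omega>" and "v \<in> L2 \<Omega>" "w \<in> L2 \<Omega>"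
    and "has_weak_partial \<Omega> j v g" "has_weak_partial \<Omega> j w h"
  shows "has_weak_partial \<Omega> j (\<lambda>x. v x - w x) (\<lambda>x. g x - h x)"
  using assms test_fun_L2[OF \<Omega>] test_fun_partial_deriv_L2[OF \<Omega>]
  by (auto simp: has_weak_partial_def L2_inner_diff_left L2_diff)

lemma has_weak_partial_combination:
  assumes \<Omega>: "\<Omega> \<in> sets lebesgue" "bounded \<Omega>"
    and "\<And>k. k \<in> K \<Longrightarrow> f k \<in> L2 \<Omega>" "\<And>k. k \<in> K \<Longrightarrow> has_weak_partial \<Omega> j (f k) (g k)"
  shows "has_weak_partial \<Omega> j (\<lambda>x. \<Sum>k\<in>K. c k * f k x) (\<lambda>x. \<Sum>k\<in>K. c k * g k x)"
  using assms test_fun_L2[OF \<Omega>] test_fun_partial_deriv_L2[OF \<Omega>]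
  by (simp add: has_weak_partial_def L2_sum L2_scale L2_inner_sum_left sum_negf)

text \<open>Weak differentiation is a closed operator: for a fixed test function both sides of the
  defining identity are inner products with a fixed \<open>L2\<close> function. This permits
  termwise differentiation of expansions.\<close>

lemma has_weak_partial_tendsto:
  assumes \<Omega>: "\<Omega> \<in> sets lebesgue" "bounded \<Omega>"
    and fg: "\<And>n. has_weak_partial \<Omega> j (f n) (g n)"
    and lim: "L2_tendsto \<Omega> f w" "L2_tendsto \<Omega> g h"
  shows "has_weak_partial \<Omega> j w h"
  unfolding has_weak_partial_def
proof (intro conjI ballI)
  fix \<psi> assume \<psi>: "\<psi> \<in> test_fun \<Omega>"
  have "(\<lambda>n. L2_inner \<Omega> (f n) (partial_deriv j \<psi>)) \<longlonglongrightarrow> L2_inner \<Omega> w (partial_deriv j \<psi>)"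
    by (intro L2_tendsto_inner lim test_fun_partial_deriv_L2 \<Omega> \<psi>)
  moreover have "(\<lambda>n. - L2_inner \<Omega> (g n) \<psi>) \<longlonglongrightarrow> - L2_inner \<Omega> h \<psi>"
    by (intro tendsto_minus L2_tendsto_inner lim test_fun_L2 \<Omega> \<psi>)
  ultimately show "L2_inner \<Omega> w (partial_deriv j \<psi>) = - L2_inner \<Omega> h \<psi>"
    using fg \<psi> by (auto simp: has_weak_partial_def intro: LIMSEQ_unique)
qed (use lim in \<open>simp add: L2_tendsto_def\<close>)

section \<open>The eigenbasis and the Lipschitz bound for the convection term\<close>

locale dirichlet_eigenbasis =
  fixes \<Omega> :: "(real^'d::finite) set" and \<theta> :: "nat \<Rightarrow> real" and \<phi> :: "nat \<Rightarrow> real^'d \<Rightarrow> real"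
  assumes sets_domain: "\<Omega> \<in> sets lebesgue" and bounded_domain: "bounded \<Omega>"
    and eigensystem: "dirichlet_eigensystem \<Omega> \<theta> \<phi>"

sublocale dirichlet_eigenbasis \<subseteq> L2_orthonormal_basis \<Omega> \<phi>
proof
  show "\<Omega> \<in> lmeasurable"
    using sets_domain bounded_domain by (rule bounded_set_imp_lmeasurable[rotated])
  have "\<phi> k \<in> H10 \<Omega>" for k
    using eigensystem by (simp add: dirichlet_eigensystem_def dirichlet_eigenfunction_def)
  then show "\<phi> k \<in> L2 \<Omega>" for k
    by (simp add: H10_def H1_def)
qed (use eigensystem in \<open>simp_all add: dirichlet_eigensystem_def\<close>)

context dirichlet_eigenbasis
begin

lemma eigenvalue_pos: "0 < \<theta> k"
proof -
  have "0 < \<theta> 0" "mono \<theta>" using eigensystem by (simp_all add: dirichlet_eigensystem_def)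
  then show ?thesis using monoD[of \<theta> 0 k] by simp
qed

lemma eigenfunction_H10: "\<phi> k \<in> H10 \<Omega>"
  using eigensystem by (simp add: dirichlet_eigensystem_def dirichlet_eigenfunction_def)

lemma eigenfunction_weak_partial: "has_weak_partial \<Omega> j (\<phi> k) (weak_partial \<Omega> j (\<phi> k))"
  using eigenfunction_H10[of k] by (auto simp: H10_def H1_def intro: has_weak_partial_weak_partial)

text \<open>The variational eigenvalue equation, tested with another eigenfunction.\<close>

lemma eigenfunction_gradient_inner:
  "(\<Sum>j\<in>UNIV. L2_inner \<Omega> (weak_partial \<Omega> j (\<phi> k)) (weak_partial \<Omega> j (\<phi> l))) = (if k = l then \<theta> k else 0)"
  using eigensystem eigenfunction_H10[of l] orthonormal[of k l]
  by (simp add: dirichlet_eigensystem_def dirichlet_eigenfunction_def)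

text \<open>The eigenfunctions are \<open>L\<^sup>2\<close>-limits of test functions, so their completeness
  makes the test functions dense; no construction of bump functions is needed.\<close>

lemma has_weak_partial_unique:
  assumes "has_weak_partial \<Omega> j w g" "has_weak_partial \<Omega> j w h"
  shows "L2_eq \<Omega> g h"
proof (rule L2_eqI)
  show L2: "g \<in> L2 \<Omega>" "h \<in> L2 \<Omega>" using assms by (auto dest: has_weak_partial_L2)
  fix k
  obtain \<psi> where \<psi>: "\<And>n. \<psi> n \<in> test_fun \<Omega>" "L2_tendsto \<Omega> \<psi> (\<phi> k)"
    using eigenfunction_H10[of k] by (auto simp: H10_def)
  have "L2_inner \<Omega> (\<psi> n) g = L2_inner \<Omega> (\<psi> n) h" for n
    using assms \<psi>(1)[of n] by (simp add: has_weak_partial_def L2_inner_commute[of \<Omega> "\<psi> n"])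
  then have "L2_inner \<Omega> (\<phi> k) g = L2_inner \<Omega> (\<phi> k) h"
    using L2_tendsto_inner[OF \<psi>(2) L2(1)] L2_tendsto_inner[OF \<psi>(2) L2(2)]
    by (simp add: LIMSEQ_unique)
  then show "L2_inner \<Omega> g (\<phi> k) = L2_inner \<Omega> h (\<phi> k)"
    by (simp add: L2_inner_commute)
qed

lemma combination_gradient_norm:
  assumes "finite K"
  shows "(\<Sum>j\<in>UNIV. (L2_norm \<Omega> (\<lambda>x. \<Sum>k\<in>K. c k * weak_partial \<Omega> j (\<phi> k) x))\<^sup>2) = (\<Sum>k\<in>K. \<theta> k * (c k)\<^sup>2)"
proof -
  note L2 = has_weak_partial_L2[OF eigenfunction_weak_partial]
  have "(\<Sum>j\<in>UNIV. (L2_norm \<Omega> (\<lambda>x. \<Sum>k\<in>K. c k * weak_partial \<Omega> j (\<phi> k) x))\<^sup>2)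
      = (\<Sum>j\<in>UNIV. \<Sum>k\<in>K. \<Sum>l\<in>K. c k * c l * L2_inner \<Omega> (weak_partial \<Omega> j (\<phi> k)) (weak_partial \<Omega> j (\<phi> l)))"
    by (simp add: L2_norm_power2 L2_inner_sum_left L2_inner_sum_right L2 L2_scale L2_sum
        sum_distrib_left mult.assoc)
  \<comment> \<open>Orthogonality of gradients is available only after summing over the directions
    \<open>j\<close>, so that sum is moved innermost.\<close>
  also have "\<dots> = (\<Sum>k\<in>K. \<Sum>l\<in>K. c k * c l * (\<Sum>j\<in>UNIV. L2_inner \<Omega> (weak_partial \<Omega> j (\<phi> k)) (weak_partial \<Omega> j (\<phi> l))))"
    unfolding sum_distrib_left
    by (subst sum.swap, intro sum.cong refl, subst sum.swap, rule refl)
  also have "\<dots> = (\<Sum>k\<in>K. \<theta> k * (c k)\<^sup>2)"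
    using assms by (simp add: eigenfunction_gradient_inner if_distrib power2_eq_square mult_ac cong: if_cong)
  finally show ?thesis .
qed

section \<open>The D^1 norm through its finite truncations\<close>

lemma D_space_1_iff:
  "w \<in> D_space \<Omega> \<theta> \<phi> 1 \<longleftrightarrow> w \<in> L2 \<Omega> \<and> summable (\<lambda>k. \<theta> k * (L2_inner \<Omega> w (\<phi> k))\<^sup>2)"
  using eigenvalue_pos by (simp add: D_space_def less_imp_le)

lemma D_norm_1: "D_norm \<Omega> \<theta> \<phi> 1 w = sqrt (\<Sum>k. \<theta> k * (L2_inner \<Omega> w (\<phi> k))\<^sup>2)"
  using eigenvalue_pos by (simp add: D_norm_def less_imp_le)

lemma D_norm_1_power2:
  "w \<in> D_space \<Omega> \<theta> \<phi> 1 \<Longrightarrow> (D_norm \<Omega> \<theta> \<phi> 1 w)\<^sup>2 = (\<Sum>k. \<theta> k * (L2_inner \<Omega> w (\<phi> k))\<^sup>2)"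
  using eigenvalue_pos by (simp add: D_norm_1 D_space_1_iff suminf_nonneg less_imp_le)

lemma partial_sum_le_D_norm:
  assumes "w \<in> D_space \<Omega> \<theta> \<phi> 1"
  shows "(\<Sum>k<n. \<theta> k * (L2_inner \<Omega> w (\<phi> k))\<^sup>2) \<le> (D_norm \<Omega> \<theta> \<phi> 1 w)\<^sup>2"
  unfolding D_norm_1_power2[OF assms]
  using assms eigenvalue_pos by (intro sum_le_suminf) (auto simp: D_space_1_iff less_imp_le)

lemma D_norm_1_nonneg: "w \<in> D_space \<Omega> \<theta> \<phi> 1 \<Longrightarrow> 0 \<le> D_norm \<Omega> \<theta> \<phi> 1 w"
  using eigenvalue_pos by (simp add: D_norm_1 D_space_1_iff suminf_nonneg less_imp_le)

text \<open>\<open>L2_set\<close> on \<open>{..<n}\<close> is the Euclidean norm of the first n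
  weighted coefficients. On D^1 the norm is the supremum of these, which lets finite-dimensional
  triangle and Minkowski inequalities act on it.\<close>

lemma L2_set_power2:
  "(L2_set (\<lambda>k. sqrt (\<theta> k) * L2_inner \<Omega> w (\<phi> k)) {..<n})\<^sup>2 = (\<Sum>k<n. \<theta> k * (L2_inner \<Omega> w (\<phi> k))\<^sup>2)"
  using eigenvalue_pos by (simp add: L2_set_def power_mult_distrib sum_nonneg less_imp_le)

lemma L2_set_le_D_norm:
  assumes "w \<in> D_space \<Omega> \<theta> \<phi> 1"
  shows "L2_set (\<lambda>k. sqrt (\<theta> k) * L2_inner \<Omega> w (\<phi> k)) {..<n} \<le> D_norm \<Omega> \<theta> \<phi> 1 w"
  by (rule power2_le_imp_le) (simp_all add: L2_set_power2 assms partial_sum_le_D_norm D_norm_1_nonneg)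

text \<open>Uniformly bounded truncations force convergence of the series; without it
  \<open>suminf\<close> would carry no information.\<close>

lemma D_norm_le:
  assumes "\<And>n. L2_set (\<lambda>k. sqrt (\<theta> k) * L2_inner \<Omega> w (\<phi> k)) {..<n} \<le> B"
  shows "D_norm \<Omega> \<theta> \<phi> 1 w \<le> B"
proof -
  have B: "0 \<le> B" using assms[of 0] by simp
  have le: "(\<Sum>k<n. \<theta> k * (L2_inner \<Omega> w (\<phi> k))\<^sup>2) \<le> B\<^sup>2" for n
    using power_mono[OF assms, of n 2] by (simp add: L2_set_power2)
  have "summable (\<lambda>k. \<theta> k * (L2_inner \<Omega> w (\<phi> k))\<^sup>2)"
    using le[of "Suc _"] eigenvalue_pos
    by (intro bounded_imp_summable[where B = "B\<^sup>2"]) (auto simp: lessThan_Suc_atMost less_imp_le)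
  then have "(\<Sum>k. \<theta> k * (L2_inner \<Omega> w (\<phi> k))\<^sup>2) \<le> B\<^sup>2"
    by (rule suminf_le_const) (rule le)
  then show ?thesis
    using B unfolding D_norm_1 by (simp add: real_le_lsqrt)
qed

text \<open>Stated for dominated coefficients rather than for a sum of functions, so that it covers
  v - u as well as u = (u - v) + v.\<close>

lemma D_norm_le_add:
  assumes v: "v \<in> D_space \<Omega> \<theta> \<phi> 1" and w: "w \<in> D_space \<Omega> \<theta> \<phi> 1"
    and le: "\<And>k. \<bar>L2_inner \<Omega> z (\<phi> k)\<bar> \<le> \<bar>L2_inner \<Omega> v (\<phi> k)\<bar> + \<bar>L2_inner \<Omega> w (\<phi> k)\<bar>"
  shows "D_norm \<Omega> \<theta> \<phi> 1 z \<le> D_norm \<Omega> \<theta> \<phi> 1 v + D_norm \<Omega> \<theta> \<phi> 1 w"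
proof (rule D_norm_le)
  fix n
  let ?a = "\<lambda>u k. sqrt (\<theta> k) * L2_inner \<Omega> u (\<phi> k)"
  have abs: "L2_set (\<lambda>k. \<bar>?a u k\<bar>) {..<n} = L2_set (?a u) {..<n}" for u
    by (simp add: L2_set_def)
  have "\<bar>?a z k\<bar> \<le> \<bar>?a v k\<bar> + \<bar>?a w k\<bar>" for k
    using mult_left_mono[OF le, of "sqrt (\<theta> k)" k] eigenvalue_pos[of k]
    by (simp add: abs_mult distrib_left)
  then have "L2_set (\<lambda>k. \<bar>?a z k\<bar>) {..<n} \<le> L2_set (\<lambda>k. \<bar>?a v k\<bar> + \<bar>?a w k\<bar>) {..<n}"
    by (intro L2_set_mono) auto
  also have "\<dots> \<le> L2_set (\<lambda>k. \<bar>?a v k\<bar>) {..<n} + L2_set (\<lambda>k. \<bar>?a w k\<bar>) {..<n}"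
    by (rule L2_set_triangle_ineq)
  finally show "L2_set (?a z) {..<n} \<le> D_norm \<Omega> \<theta> \<phi> 1 v + D_norm \<Omega> \<theta> \<phi> 1 w"
    using L2_set_le_D_norm[OF v, of n] L2_set_le_D_norm[OF w, of n] unfolding abs by linarith
qed

lemma D_space_diff:
  assumes v: "v \<in> D_space \<Omega> \<theta> \<phi> 1" and w: "w \<in> D_space \<Omega> \<theta> \<phi> 1"
  shows "(\<lambda>x. v x - w x) \<in> D_space \<Omega> \<theta> \<phi> 1"
proof -
  let ?c = "\<lambda>u k. L2_inner \<Omega> u (\<phi> k)"
  have "summable (\<lambda>k. 2 * (\<theta> k * (?c v k)\<^sup>2) + 2 * (\<theta> k * (?c w k)\<^sup>2))"
    using v w by (intro summable_add summable_mult) (auto simp: D_space_1_iff)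
  moreover have "(a - b)\<^sup>2 \<le> 2 * a\<^sup>2 + 2 * b\<^sup>2" for a b :: real
    using sum_squares_bound[of a "-b"] by (simp add: power2_diff)
  then have "norm (\<theta> k * (?c (\<lambda>x. v x - w x) k)\<^sup>2) \<le> 2 * (\<theta> k * (?c v k)\<^sup>2) + 2 * (\<theta> k * (?c w k)\<^sup>2)" for k
    using v w eigenvalue_pos[of k]
    by (simp add: D_space_1_iff L2_inner_diff_left basis_L2)
      (metis (no_types, opaque_lifting) distrib_left less_imp_le mult.left_commute mult_left_mono)
  ultimately have "summable (\<lambda>k. \<theta> k * (?c (\<lambda>x. v x - w x) k)\<^sup>2)"
    by (rule summable_comparison_test'[where N = 0])
  then show ?thesis using v w by (simp add: D_space_1_iff L2_diff)
qed

text \<open>The candidate is the termwise derivative of the eigenfunction expansion. Its blocks over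
  \<open>{n..<m}\<close> are bounded by blocks of the D^1 series, so it converges, and closedness
  makes the limit a weak derivative. This also gives the choice in \<open>weak_partial\<close> a
  meaning on D^1.\<close>

lemma D_space_weak_partial:
  assumes w: "w \<in> D_space \<Omega> \<theta> \<phi> 1"
  obtains g where "has_weak_partial \<Omega> j w g" "L2_norm \<Omega> g \<le> D_norm \<Omega> \<theta> \<phi> 1 w"
proof -
  let ?c = "\<lambda>k. L2_inner \<Omega> w (\<phi> k)"
  let ?g = "\<lambda>n x. \<Sum>k<n. ?c k * weak_partial \<Omega> j (\<phi> k) x"
  have w_L2: "w \<in> L2 \<Omega>" and sm: "summable (\<lambda>k. \<theta> k * (?c k)\<^sup>2)"
    using w by (auto simp: D_space_1_iff)
  \<comment> \<open>A single direction is bounded by the sum over all directions, which is known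
    exactly.\<close>
  have le: "(L2_norm \<Omega> (\<lambda>x. \<Sum>k\<in>K. ?c k * weak_partial \<Omega> j (\<phi> k) x))\<^sup>2 \<le> (\<Sum>k\<in>K. \<theta> k * (?c k)\<^sup>2)"
    if "finite K" for K
    unfolding combination_gradient_norm[OF that, symmetric] by (intro member_le_sum) auto
  have g_L2: "?g n \<in> L2 \<Omega>" for n
    by (intro L2_sum L2_scale has_weak_partial_L2[OF eigenfunction_weak_partial])
  have "\<exists>N. \<forall>m\<ge>N. \<forall>n\<ge>N. L2_norm \<Omega> (\<lambda>x. ?g m x - ?g n x) < e" if e: "e > 0" for e
  proof -
    have "e\<^sup>2 > 0" using e by simp
    then obtain N where N: "\<And>m n. n \<ge> N \<Longrightarrow> norm (\<Sum>k=n..<m. \<theta> k * (?c k)\<^sup>2) < e\<^sup>2"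
      using sm unfolding summable_Cauchy by blast
    have ord: "L2_norm \<Omega> (\<lambda>x. ?g m x - ?g n x) < e" if "n \<le> m" "N \<le> n" for m n
    proof -
      have "?g m x - ?g n x = (\<Sum>k\<in>{n..<m}. ?c k * weak_partial \<Omega> j (\<phi> k) x)" for x
        using that by (simp add: sum_diff_nat_ivl lessThan_atLeast0)
      then have "(L2_norm \<Omega> (\<lambda>x. ?g m x - ?g n x))\<^sup>2 < e\<^sup>2"
        using le[of "{n..<m}"] N[OF that(2), of m] by simp
      then show ?thesis using e by (simp add: power2_less_imp_less)
    qed
    have "L2_norm \<Omega> (\<lambda>x. ?g m x - ?g n x) < e" if "m \<ge> N" "n \<ge> N" for m n
      using ord[of n m] ord[of m n] that L2_norm_minus_commute[of \<Omega> "?g m" "?g n"]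
      by (cases "n \<le> m") auto
    then show ?thesis by blast
  qed
  then obtain g where g: "L2_tendsto \<Omega> ?g g"
    using L2_complete[of \<Omega> ?g, OF lmeasurable g_L2] by blast
  have "has_weak_partial \<Omega> j w g"
    by (rule has_weak_partial_tendsto[OF sets_domain bounded_domain _ expansion_tendsto[OF w_L2] g])
      (intro has_weak_partial_combination sets_domain bounded_domain basis_L2 eigenfunction_weak_partial)
  moreover have "L2_norm \<Omega> (?g n) \<le> D_norm \<Omega> \<theta> \<phi> 1 w" for n
    by (rule power2_le_imp_le[OF order_trans[OF le[OF finite_lessThan] partial_sum_le_D_norm[OF w]]
          D_norm_1_nonneg[OF w]])
  then have "L2_norm \<Omega> g \<le> D_norm \<Omega> \<theta> \<phi> 1 w"
    using L2_tendsto_norm[OF g] by (intro LIMSEQ_le_const2) auto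
  ultimately show ?thesis by (rule that)
qed

lemma convection_L2:
  assumes "w \<in> D_space \<Omega> \<theta> \<phi> 1"
  shows "convection \<Omega> \<eta> w \<in> L2 \<Omega>"
  unfolding convection_def
  by (intro L2_sum L2_scale)
    (metis D_space_weak_partial[OF assms] has_weak_partial_weak_partial has_weak_partial_L2)

text \<open>The difference of the two chosen derivatives is a weak derivative of v - w, though
  perhaps not the chosen one; by uniqueness it has the norm of the one that the D^1 norm
  bounds.\<close>

lemma convection_Lipschitz:
  assumes v: "v \<in> D_space \<Omega> \<theta> \<phi> 1" and w: "w \<in> D_space \<Omega> \<theta> \<phi> 1"
  shows "L2_norm \<Omega> (\<lambda>x. convection \<Omega> \<eta> v x - convection \<Omega> \<eta> w x)
           \<le> (\<Sum>j\<in>UNIV. \<bar>\<eta> $ j\<bar>) * D_norm \<Omega> \<theta> \<phi> 1 (\<lambda>x. v x - w x)"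
proof -
  let ?d = "\<lambda>j x. weak_partial \<Omega> j v x - weak_partial \<Omega> j w x"
  have wp: "has_weak_partial \<Omega> j u (weak_partial \<Omega> j u)" if "u \<in> D_space \<Omega> \<theta> \<phi> 1" for u j
    by (metis D_space_weak_partial[OF that] has_weak_partial_weak_partial)
  have d_L2: "?d j \<in> L2 \<Omega>" for j
    using wp v w by (intro L2_diff has_weak_partial_L2)
  have d_le: "L2_norm \<Omega> (?d j) \<le> D_norm \<Omega> \<theta> \<phi> 1 (\<lambda>x. v x - w x)" for j
  proof -
    obtain g where g: "has_weak_partial \<Omega> j (\<lambda>x. v x - w x) g" "L2_norm \<Omega> g \<le> D_norm \<Omega> \<theta> \<phi> 1 (\<lambda>x. v x - w x)"
      using D_space_weak_partial[OF D_space_diff[OF v w]] by blast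
    have "has_weak_partial \<Omega> j (\<lambda>x. v x - w x) (?d j)"
      using v w by (intro has_weak_partial_diff sets_domain bounded_domain wp) (auto simp: D_space_1_iff)
    then have "L2_norm \<Omega> (?d j) = L2_norm \<Omega> g"
      using g(1) by (intro L2_norm_cong_AE has_weak_partial_unique) (auto dest: has_weak_partial_L2)
    with g(2) show ?thesis by simp
  qed
  have "L2_norm \<Omega> (\<lambda>x. convection \<Omega> \<eta> v x - convection \<Omega> \<eta> w x)
      = L2_norm \<Omega> (\<lambda>x. \<Sum>j\<in>UNIV. \<eta> $ j * ?d j x)"
    by (simp add: convection_def sum_subtractf right_diff_distrib)
  also have "\<dots> \<le> (\<Sum>j\<in>UNIV. L2_norm \<Omega> (\<lambda>x. \<eta> $ j * ?d j x))"
    by (intro L2_norm_sum_le L2_scale d_L2)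
  also have "\<dots> \<le> (\<Sum>j\<in>UNIV. \<bar>\<eta> $ j\<bar> * D_norm \<Omega> \<theta> \<phi> 1 (\<lambda>x. v x - w x))"
    by (intro sum_mono) (simp add: d_le mult_left_mono del: right_diff_distrib)
  finally show ?thesis by (simp add: sum_distrib_right)
qed

end

section \<open>Mittag-Leffler functions\<close>

text \<open>Euler's integral restricted to \<open>{R..R+1}\<close>, with each factor replaced by its
  minimum there. As \<open>R\<close> is free, Gamma outgrows every geometric sequence.\<close>

lemma Gamma_lower_bound:
  fixes x R :: real
  assumes "1 \<le> x" "0 < R"
  shows "R powr (x - 1) * exp (- (R + 1)) \<le> Gamma x"
proof -
  let ?c = "R powr (x - 1) * exp (- (R + 1))"
  have "ennreal ?c = (\<integral>\<^sup>+t. ennreal ?c * indicator {R..R+1} t \<partial>lborel)"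
    by (simp add: nn_integral_cmult_indicator)
  also have "\<dots> \<le> (\<integral>\<^sup>+t. ennreal (indicator {0..} t * t powr (x - 1) / exp t) \<partial>lborel)"
  proof (rule nn_integral_mono)
    fix t :: real
    have "?c \<le> t powr (x - 1) / exp t" if "R \<le> t" "t \<le> R + 1"
    proof -
      have "?c \<le> t powr (x - 1) * exp (- t)"
        using that assms by (intro mult_mono powr_mono2) auto
      then show ?thesis by (simp add: exp_minus divide_inverse)
    qed
    then show "ennreal ?c * indicator {R..R+1} t \<le> ennreal (indicator {0..} t * t powr (x - 1) / exp t)"
      using assms by (auto split: split_indicator intro!: ennreal_leI)
  qed
  also have "\<dots> = ennreal (Gamma x)"
    using assms by (simp add: Gamma_conv_nn_integral_real)
  finally show ?thesis
    using assms by (subst (asm) ennreal_le_iff) (auto intro: Gamma_real_nonneg)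
qed

lemma summable_mittag_leffler:
  fixes \<alpha> \<zeta> X :: real
  assumes "0 < \<alpha>" "0 \<le> X"
  shows "summable (\<lambda>k. X ^ k / Gamma (\<alpha> * real k + \<zeta>))"
proof -
  \<comment> \<open>Chosen so that \<open>R powr \<alpha> = 2 * X + 1\<close>: the terms are then
    dominated by powers of X / (2 X + 1), at most 1/2. The summand 1 keeps \<open>R\<close> positive
    when X = 0.\<close>
  define R where "R = (2 * X + 1) powr (1 / \<alpha>)"
  have R: "0 < R" "R powr \<alpha> = 2 * X + 1"
    using assms by (simp_all add: R_def powr_powr)
  define C where "C = exp (R + 1) * R powr (1 - \<zeta>)"
  \<comment> \<open>Beyond this threshold \<open>\<alpha> * real k + \<zeta>\<close> is at least 1,
    as the Gamma bound requires.\<close>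
  have "norm (X ^ k / Gamma (\<alpha> * real k + \<zeta>)) \<le> C * (1/2) ^ k" if k: "nat \<lceil>(1 - \<zeta>) / \<alpha>\<rceil> \<le> k" for k
  proof -
    let ?x = "\<alpha> * real k + \<zeta>"
    have "(1 - \<zeta>) / \<alpha> \<le> real k" using k by linarith
    then have x: "1 \<le> ?x" using assms(1) by (simp add: field_simps)
    have "R powr (\<alpha> * real k) = (2 * X + 1) ^ k"
      using R assms by (simp add: powr_powr[symmetric] powr_realpow)
    then have "R powr (?x - 1) = (2 * X + 1) ^ k / R powr (1 - \<zeta>)"
      using R(1) by (simp add: powr_diff powr_add)
    then have "(2 * X + 1) ^ k / C = R powr (?x - 1) * exp (- (R + 1))"
      unfolding exp_minus by (simp add: C_def divide_inverse)
    also have "\<dots> \<le> Gamma ?x"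
      using x R(1) by (rule Gamma_lower_bound)
    finally have le: "(2 * X + 1) ^ k / C \<le> Gamma ?x" .
    have "0 < C" using R(1) by (simp add: C_def)
    have "0 < (2 * X + 1) ^ k / C" using \<open>0 < C\<close> assms by simp
    then have "X ^ k / Gamma ?x \<le> X ^ k / ((2 * X + 1) ^ k / C)"
      using le assms by (intro divide_left_mono mult_pos_pos) auto
    also have "\<dots> = C * (X / (2 * X + 1)) ^ k"
      by (simp add: power_divide)
    also have "\<dots> \<le> C * (1/2) ^ k"
      using \<open>0 < C\<close> assms by (intro mult_left_mono power_mono) (auto simp: field_simps)
    finally have "X ^ k / Gamma ?x \<le> C * (1/2) ^ k" .
    moreover have "0 \<le> X ^ k / Gamma ?x"
      using x assms(2) by (intro divide_nonneg_nonneg Gamma_real_nonneg) auto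
    ultimately show ?thesis by (simp only: real_norm_def abs_of_nonneg)
  qed
  then show ?thesis
    by (rule summable_comparison_test'[of "\<lambda>k. C * (1/2) ^ k" "nat \<lceil>(1 - \<zeta>) / \<alpha>\<rceil>", rotated])
      (simp_all add: summable_mult summable_geometric)
qed

text \<open>Termwise comparison: Gamma is positive at all arguments that occur, so only the powers
  of \<open>z\<close> carry signs.\<close>

lemma abs_mittag_leffler_le:
  fixes \<alpha> \<zeta> z X :: real
  assumes "0 < \<alpha>" "0 < \<zeta>" "\<bar>z\<bar> \<le> X"
  shows "\<bar>mittag_leffler \<alpha> \<zeta> z\<bar> \<le> mittag_leffler \<alpha> \<zeta> X"
  unfolding mittag_leffler_def real_norm_def[symmetric]
proof (rule norm_suminf_le)
  fix k
  have "0 < Gamma (\<alpha> * real k + \<zeta>)"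
    using assms by (intro Gamma_real_pos add_nonneg_pos) auto
  then show "norm (z ^ k / Gamma (\<alpha> * real k + \<zeta>)) \<le> X ^ k / Gamma (\<alpha> * real k + \<zeta>)"
    using assms by (simp add: power_abs divide_right_mono power_mono)
qed (use assms in \<open>simp add: summable_mittag_leffler\<close>)

lemma mittag_leffler_nonneg:
  fixes \<alpha> \<zeta> X :: real
  assumes "0 < \<alpha>" "0 < \<zeta>" "0 \<le> X"
  shows "0 \<le> mittag_leffler \<alpha> \<zeta> X"
  using abs_mittag_leffler_le[OF assms(1,2), of 0 X] assms(3) by simp

section \<open>Integrals with values in \<open>L\<^sup>2(\<Omega>)\<close>\<close>

text \<open>Lebesgue measure is complete; extension by zero reduces the claim to the whole
  space.\<close>

lemma borel_measurable_lebesgue_on_AE: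
  fixes f g :: "'a::euclidean_space \<Rightarrow> real"
  assumes S: "S \<in> sets lebesgue" and f: "f \<in> borel_measurable (lebesgue_on S)"
    and AE: "AE x in lebesgue_on S. f x = g x"
  shows "g \<in> borel_measurable (lebesgue_on S)"
proof -
  have "(\<lambda>x. indicator S x *\<^sub>R f x) \<in> borel_measurable lebesgue"
    using f S by (subst (asm) borel_measurable_restrict_space_iff) (auto simp: scaleR_conv_of_real)
  moreover have "AE x in lebesgue. indicator S x *\<^sub>R f x = indicator S x *\<^sub>R g x"
    using AE S by (subst (asm) AE_restrict_space_iff) (auto elim: eventually_mono split: split_indicator)
  ultimately have "(\<lambda>x. indicator S x *\<^sub>R g x) \<in> borel_measurable lebesgue"
    by (rule borel_measurable_AE)
  then show ?thesis
    using S by (subst borel_measurable_restrict_space_iff) (auto simp: scaleR_conv_of_real)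
qed

lemma L2_simple_inner:
  assumes "L2_simple \<Omega> M s p" "h \<in> L2 \<Omega>"
  shows "s \<tau> \<in> L2 \<Omega>"
    and "integrable M (\<lambda>\<tau>. L2_inner \<Omega> (s \<tau>) h)"
    and "(\<integral>\<tau>. L2_inner \<Omega> (s \<tau>) h \<partial>M) = L2_inner \<Omega> p h"
proof -
  obtain m :: nat and A w where Aw: "\<And>i. i < m \<Longrightarrow> A i \<in> sets M \<and> emeasure M (A i) < \<infinity> \<and> w i \<in> L2 \<Omega>"
    and s: "s = (\<lambda>\<tau> x. \<Sum>i<m. indicator (A i) \<tau> * w i x)"
    and p: "p = (\<lambda>x. \<Sum>i<m. measure M (A i) * w i x)"
    using assms(1) unfolding L2_simple_def by blast
  show "s \<tau> \<in> L2 \<Omega>"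
    unfolding s using Aw by (intro L2_sum L2_scale) auto
  have inner: "L2_inner \<Omega> (s \<tau>) h = (\<Sum>i<m. indicator (A i) \<tau> * L2_inner \<Omega> (w i) h)" for \<tau>
    unfolding s using Aw assms(2) by (subst L2_inner_sum_left) (auto intro: L2_scale)
  have int: "integrable M (\<lambda>\<tau>. indicator (A i) \<tau> * L2_inner \<Omega> (w i) h)" if "i < m" for i
    using Aw[OF that] by (intro integrable_mult_left integrable_real_indicator) auto
  show "integrable M (\<lambda>\<tau>. L2_inner \<Omega> (s \<tau>) h)"
    unfolding inner by (intro Bochner_Integration.integrable_sum int) simp
  have "(\<integral>\<tau>. L2_inner \<Omega> (s \<tau>) h \<partial>M) = (\<Sum>i<m. measure M (A i) * L2_inner \<Omega> (w i) h)"
    unfolding inner using Aw sets.sets_into_space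
    by (subst Bochner_Integration.integral_sum) (auto intro!: int sum.cong simp: Int_absorb2)
  also have "\<dots> = L2_inner \<Omega> p h"
    unfolding p using Aw assms(2) by (subst L2_inner_sum_left) (auto intro: L2_scale)
  finally show "(\<integral>\<tau>. L2_inner \<Omega> (s \<tau>) h \<partial>M) = L2_inner \<Omega> p h" .
qed

text \<open>For simple functions pairing with \<open>h\<close> commutes with the integral;
  Cauchy-Schwarz turns convergence in norm into L^1 convergence of the scalar functions. The bound
  on the norm of \<open>h\<close> removes a factor and holds for every
  \<open>\<phi> k\<close>.\<close>

lemma has_L2_integral_inner:
  assumes S: "S \<in> sets lebesgue" and F: "has_L2_integral \<Omega> (lebesgue_on S) F q"
    and h: "h \<in> L2 \<Omega>" "L2_norm \<Omega> h \<le> 1"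
  shows "integrable (lebesgue_on S) (\<lambda>\<tau>. L2_inner \<Omega> (F \<tau>) h)"
    and "(\<integral>\<tau>. L2_inner \<Omega> (F \<tau>) h \<partial>lebesgue_on S) = L2_inner \<Omega> q h"
    and "q \<in> L2 \<Omega>"
proof -
  let ?M = "lebesgue_on S"
  obtain s p where F_L2: "\<And>\<tau>. \<tau> \<in> space ?M \<Longrightarrow> F \<tau> \<in> L2 \<Omega>"
    and simple: "\<And>n. L2_simple \<Omega> ?M (s n) (p n)"
    and AE: "AE \<tau> in ?M. L2_tendsto \<Omega> (\<lambda>n. s n \<tau>) (F \<tau>)"
    and L1: "(\<lambda>n. \<integral>\<^sup>+\<tau>. ennreal (L2_norm \<Omega> (\<lambda>x. s n \<tau> x - F \<tau> x)) \<partial>?M) \<longlonglongrightarrow> 0"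
    and p: "L2_tendsto \<Omega> p q"
    using F unfolding has_L2_integral_def by blast
  show "q \<in> L2 \<Omega>" using p by (simp add: L2_tendsto_def)
  let ?a = "\<lambda>n \<tau>. L2_inner \<Omega> (s n \<tau>) h" and ?b = "\<lambda>\<tau>. L2_inner \<Omega> (F \<tau>) h"
  note s = L2_simple_inner[OF simple h(1)]
  have a_meas: "?a n \<in> borel_measurable ?M" for n
    using s(2) by (rule borel_measurable_integrable)
  \<comment> \<open>\<open>?b\<close> is the limit of the \<open>?a n\<close> only almost
    everywhere, hence the detour through \<open>lim\<close> and completeness of the measure.\<close>
  have b_meas: "?b \<in> borel_measurable ?M"
  proof (rule borel_measurable_lebesgue_on_AE[OF S])
    show "(\<lambda>\<tau>. lim (\<lambda>n. ?a n \<tau>)) \<in> borel_measurable ?M"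
      using a_meas by (rule borel_measurable_lim_metric)
    show "AE \<tau> in ?M. lim (\<lambda>n. ?a n \<tau>) = ?b \<tau>"
      using AE by eventually_elim (simp add: L2_tendsto_inner h(1) limI)
  qed
  have le: "(\<integral>\<^sup>+\<tau>. ennreal (norm (?a n \<tau> - ?b \<tau>)) \<partial>?M)
      \<le> (\<integral>\<^sup>+\<tau>. ennreal (L2_norm \<Omega> (\<lambda>x. s n \<tau> x - F \<tau> x)) \<partial>?M)" for n
  proof (intro nn_integral_mono ennreal_leI)
    fix \<tau> assume \<tau>: "\<tau> \<in> space ?M"
    have "norm (?a n \<tau> - ?b \<tau>) = \<bar>L2_inner \<Omega> (\<lambda>x. s n \<tau> x - F \<tau> x) h\<bar>"
      using s(1) F_L2[OF \<tau>] h(1) by (simp add: L2_inner_diff_left)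
    also have "\<dots> \<le> L2_norm \<Omega> (\<lambda>x. s n \<tau> x - F \<tau> x) * L2_norm \<Omega> h"
      using s(1) F_L2[OF \<tau>] h(1) by (intro L2_Cauchy_Schwarz L2_diff)
    also have "\<dots> \<le> L2_norm \<Omega> (\<lambda>x. s n \<tau> x - F \<tau> x)"
      using h(2) by (intro mult_left_le) auto
    finally show "norm (?a n \<tau> - ?b \<tau>) \<le> L2_norm \<Omega> (\<lambda>x. s n \<tau> x - F \<tau> x)" .
  qed
  have lim: "(\<lambda>n. \<integral>\<^sup>+\<tau>. ennreal (norm (?a n \<tau> - ?b \<tau>)) \<partial>?M) \<longlonglongrightarrow> 0"
    by (rule tendsto_sandwich[OF _ _ tendsto_const L1]) (use le in auto)
  \<comment> \<open>One \<open>n\<close> at L^1 distance below 1 suffices: \<open>?b\<close> is then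
    integrable as \<open>?a n\<close> minus an integrable difference.\<close>
  then have "\<forall>\<^sub>F n in sequentially. (\<integral>\<^sup>+\<tau>. ennreal (norm (?a n \<tau> - ?b \<tau>)) \<partial>?M) < 1"
    by (rule order_tendstoD) simp
  then obtain n where n: "(\<integral>\<^sup>+\<tau>. ennreal (norm (?a n \<tau> - ?b \<tau>)) \<partial>?M) < 1"
    by (auto simp: eventually_sequentially)
  have "integrable ?M (\<lambda>\<tau>. ?a n \<tau> - ?b \<tau>)"
    using n a_meas b_meas by (intro integrableI_bounded) (auto intro: less_trans)
  from Bochner_Integration.integrable_diff[OF s(2)[of n] this]
  show b_int: "integrable ?M ?b" by simp
  have "(\<lambda>n. \<integral>\<tau>. ?a n \<tau> \<partial>?M) \<longlonglongrightarrow> (\<integral>\<tau>. ?b \<tau> \<partial>?M)"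
    by (rule tendsto_L1_int[OF s(2) b_int lim])
  then show "(\<integral>\<tau>. ?b \<tau> \<partial>?M) = L2_inner \<Omega> q h"
    using L2_tendsto_inner[OF p h(1)] unfolding s(3) by (rule LIMSEQ_unique)
qed

text \<open>Minkowski's integral inequality, by duality: the square of the left-hand side is the integral of a pointwise inner product.\<close>

lemma L2_set_integral_le:
  fixes f :: "'i \<Rightarrow> 'a \<Rightarrow> real"
  assumes f: "\<And>k. k \<in> K \<Longrightarrow> integrable M (f k)" and g: "integrable M g"
    and le: "\<And>x. x \<in> space M \<Longrightarrow> L2_set (\<lambda>k. f k x) K \<le> g x"
  shows "L2_set (\<lambda>k. \<integral>x. f k x \<partial>M) K \<le> (\<integral>x. g x \<partial>M)"
proof -
  let ?c = "\<lambda>k. \<integral>x. f k x \<partial>M"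
  let ?N = "L2_set ?c K"
  have g_nonneg: "0 \<le> (\<integral>x. g x \<partial>M)"
    using order_trans[OF L2_set_nonneg le] by (intro Bochner_Integration.integral_nonneg)
  have "?N * ?N = (\<Sum>k\<in>K. ?c k * ?c k)"
    by (simp add: L2_set_def sum_nonneg power2_eq_square)
  also have "\<dots> = (\<integral>x. (\<Sum>k\<in>K. ?c k * f k x) \<partial>M)"
    using f by (subst Bochner_Integration.integral_sum) auto
  also have "\<dots> \<le> (\<integral>x. ?N * g x \<partial>M)"
  proof (rule integral_mono)
    fix x assume x: "x \<in> space M"
    have "(\<Sum>k\<in>K. ?c k * f k x) \<le> (\<Sum>k\<in>K. \<bar>?c k\<bar> * \<bar>f k x\<bar>)"
      by (intro sum_mono) (metis abs_ge_self abs_mult)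
    also have "\<dots> \<le> ?N * L2_set (\<lambda>k. f k x) K"
      by (rule L2_set_mult_ineq)
    also have "\<dots> \<le> ?N * g x"
      using le[OF x] by (intro mult_left_mono) auto
    finally show "(\<Sum>k\<in>K. ?c k * f k x) \<le> ?N * g x" .
  qed (use f g in auto)
  finally have "?N * ?N \<le> ?N * (\<integral>x. g x \<partial>M)" by simp
  \<comment> \<open>Division by \<open>?N\<close>; for \<open>?N = 0\<close> the claim is
    nonnegativity of the right-hand side.\<close>
  then show ?thesis
    using g_nonneg L2_set_nonneg[of ?c K] by (cases "?N = 0") auto
qed

section \<open>A weakly singular Gronwall inequality\<close>

text \<open>The reflection moves the singularity of the kernel from the endpoint \<open>t\<close> to
  0.\<close>

lemma lebesgue_on_reflect:
  fixes f :: "real \<Rightarrow> real"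
  shows "integrable (lebesgue_on {0..t}) (\<lambda>s. f (t - s)) \<longleftrightarrow> integrable (lebesgue_on {0..t}) f"
    and "(\<integral>s. f (t - s) \<partial>lebesgue_on {0..t}) = (\<integral>s. f s \<partial>lebesgue_on {0..t})"
proof -
  let ?h = "\<lambda>s. indicator {0..t} s *\<^sub>R f s"
  have eq: "indicator {0..t} s *\<^sub>R f (t - s) = ?h (t + -1 * s)" for s
    by (auto split: split_indicator)
  show "integrable (lebesgue_on {0..t}) (\<lambda>s. f (t - s)) \<longleftrightarrow> integrable (lebesgue_on {0..t}) f"
    using lebesgue_integrable_real_affine_iff[of "-1" ?h t] unfolding eq[symmetric]
    by (simp add: integrable_restrict_space)
  show "(\<integral>s. f (t - s) \<partial>lebesgue_on {0..t}) = (\<integral>s. f s \<partial>lebesgue_on {0..t})"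
    using lebesgue_integral_real_affine[of "-1" ?h t] unfolding eq[symmetric]
    by (simp add: integral_restrict_space)
qed

lemma integrable_powr_mult_continuous:
  fixes g :: "real \<Rightarrow> real"
  assumes "0 < \<alpha>" "0 \<le> t" "continuous_on {0..t} g"
  shows "integrable (lebesgue_on {0..t}) (\<lambda>s. s powr (\<alpha> - 1) * g s)"
proof -
  have "(\<lambda>s. s powr (\<alpha> - 1)) absolutely_integrable_on {0..t}"
    using assms by (intro nonnegative_absolutely_integrable_1 integrable_on_powr_from_0) auto
  then have powr: "integrable (lebesgue_on {0..t}) (\<lambda>s. s powr (\<alpha> - 1))"
    by (rule absolutely_integrable_imp_integrable) simp
  have "bounded (g ` {0..t})"
    using assms(3) by (intro compact_imp_bounded compact_continuous_image) auto
  then obtain B where B: "\<And>s. s \<in> {0..t} \<Longrightarrow> \<bar>g s\<bar> \<le> B"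
    unfolding bounded_iff by (metis imageI real_norm_def)
  show ?thesis
  proof (rule Bochner_Integration.integrable_bound)
    show "integrable (lebesgue_on {0..t}) (\<lambda>s. s powr (\<alpha> - 1) * B)"
      using powr by simp
    show "(\<lambda>s. s powr (\<alpha> - 1) * g s) \<in> borel_measurable (lebesgue_on {0..t})"
      using continuous_imp_measurable_on_sets_lebesgue[OF assms(3)]
      by (intro borel_measurable_times borel_measurable_integrable[OF powr]) auto
    have "norm (s powr (\<alpha> - 1) * g s) \<le> norm (s powr (\<alpha> - 1) * B)" if "s \<in> {0..t}" for s
      using B[OF that] by (simp add: abs_mult mult_left_mono)
    then show "AE s in lebesgue_on {0..t}. norm (s powr (\<alpha> - 1) * g s) \<le> norm (s powr (\<alpha> - 1) * B)"
      by (intro AE_I2) simp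
  qed
qed

lemma integrable_weakly_singular:
  fixes g :: "real \<Rightarrow> real"
  assumes "0 < \<alpha>" "0 \<le> t" "continuous_on {0..t} g"
  shows "integrable (lebesgue_on {0..t}) (\<lambda>\<tau>. (t - \<tau>) powr (\<alpha> - 1) * g \<tau>)"
proof -
  have "continuous_on {0..t} (\<lambda>s. g (t - s))"
    by (rule continuous_on_compose2[OF assms(3)]) (auto intro: continuous_intros)
  then have "integrable (lebesgue_on {0..t}) (\<lambda>s. s powr (\<alpha> - 1) * g (t - s))"
    using assms by (intro integrable_powr_mult_continuous)
  then show ?thesis
    by (subst (asm) lebesgue_on_reflect(1)[symmetric]) simp
qed

text \<open>Dominated convergence, with the integrand for \<open>n = 0\<close> as majorant. It
  supplies the contraction factor of the Gronwall argument.\<close>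

lemma powr_exp_integral_tendsto_0:
  fixes \<alpha> T :: real
  assumes "0 < \<alpha>" "0 \<le> T"
  shows "(\<lambda>n. \<integral>s. s powr (\<alpha> - 1) * exp (- real n * s) \<partial>lebesgue_on {0..T}) \<longlonglongrightarrow> 0"
proof -
  let ?M = "lebesgue_on {0..T}"
  have int: "integrable ?M (\<lambda>s. s powr (\<alpha> - 1) * exp (- real n * s))" for n
    using assms by (intro integrable_powr_mult_continuous continuous_intros)
  have "(\<lambda>n. \<integral>s. s powr (\<alpha> - 1) * exp (- real n * s) \<partial>?M) \<longlonglongrightarrow> (\<integral>s. 0 \<partial>?M)"
  proof (rule integral_dominated_convergence)
    show "integrable ?M (\<lambda>s. s powr (\<alpha> - 1))"
      using int[of 0] by simp
    \<comment> \<open>At \<open>s = 0\<close> the integrand is 0 since \<open>0 powr x = 0\<close>;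
      elsewhere it is a constant times powers of \<open>exp (- s)\<close>, which is below 1.\<close>
    have "(\<lambda>n. s powr (\<alpha> - 1) * exp (- real n * s)) \<longlonglongrightarrow> 0" if "s \<in> {0..T}" for s
    proof (cases "s = 0")
      case False
      then have "(\<lambda>n. exp (- s) ^ n) \<longlonglongrightarrow> 0"
        using that by (intro LIMSEQ_realpow_zero) auto
      then have "(\<lambda>n. s powr (\<alpha> - 1) * exp (- s) ^ n) \<longlonglongrightarrow> 0"
        by (rule tendsto_mult_right_zero)
      then show ?thesis by (simp add: exp_of_nat_mult[symmetric])
    qed simp
    then show "AE s in ?M. (\<lambda>n. s powr (\<alpha> - 1) * exp (- real n * s)) \<longlonglongrightarrow> 0"
      by (intro AE_I2) simp
    show "AE s in ?M. norm (s powr (\<alpha> - 1) * exp (- real n * s)) \<le> s powr (\<alpha> - 1)" for n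
      by (intro AE_I2) (simp add: abs_mult mult_left_le)
  qed (use int in auto)
  then show ?thesis by simp
qed

text \<open>The hypothesis bounds \<open>y\<close> by the upper integral of \<open>(t - \<tau>)\<^bsup>\<alpha>-1\<^esup> y(\<tau>)\<close>, so that \<open>y\<close> need
  not be measurable.  Weighting by \<open>exp (- n t)\<close> with \<open>n\<close> large makes the kernel a contraction.\<close>

lemma weakly_singular_Gronwall:
  fixes \<alpha> b T :: real
  assumes "0 < \<alpha>" "0 \<le> T" "0 \<le> b"
  obtains K where "K > 0"
    and "\<And>y a t. \<lbrakk>0 \<le> a; bdd_above (y ` {0..T}); \<And>t. t \<in> {0..T} \<Longrightarrow> 0 \<le> y t;
        \<And>t g. \<lbrakk>t \<in> {0..T}; continuous_on {0..t} g; \<And>\<tau>. \<tau> \<in> {0..t} \<Longrightarrow> y \<tau> \<le> g \<tau>\<rbrakk>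
          \<Longrightarrow> y t \<le> a + b * (\<integral>\<tau>. (t - \<tau>) powr (\<alpha> - 1) * g \<tau> \<partial>lebesgue_on {0..t});
        t \<in> {0..T}\<rbrakk> \<Longrightarrow> y t \<le> K * a"
proof -
  define J where "J t n = (\<integral>s. s powr (\<alpha> - 1) * exp (- real n * s) \<partial>lebesgue_on {0..t})" for t n
  have "(\<lambda>n. b * J T n) \<longlonglongrightarrow> 0"
    unfolding J_def using assms by (intro tendsto_mult_right_zero powr_exp_integral_tendsto_0)
  then have "\<forall>\<^sub>F n in sequentially. b * J T n < 1/2"
    by (rule order_tendstoD) simp
  \<comment> \<open>\<open>n\<close> is fixed before \<open>y\<close> and \<open>a\<close> appear,
    so \<open>K\<close> depends on \<open>\<alpha>\<close>, \<open>b\<close> and \<open>T\<close>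
    only.\<close>
  then obtain n where n: "b * J T n < 1/2"
    by (auto simp: eventually_sequentially)
  \<comment> \<open>Contraction is needed on every \<open>{0..t}\<close>; the integrand is
    nonnegative, so \<open>T\<close> is the worst case.\<close>
  have J_mono: "J t n \<le> J T n" if "t \<in> {0..T}" for t
  proof -
    let ?f = "\<lambda>s. s powr (\<alpha> - 1) * exp (- real n * s)"
    have int: "integrable (lebesgue_on {0..r}) ?f" if "0 \<le> r" for r
      using assms that by (intro integrable_powr_mult_continuous continuous_intros)
    have "(\<integral>s. indicator {0..t} s *\<^sub>R ?f s \<partial>lebesgue) \<le> (\<integral>s. indicator {0..T} s *\<^sub>R ?f s \<partial>lebesgue)"
      using int[of t] int[of T] that assms
      by (intro integral_mono) (auto simp: integrable_restrict_space split: split_indicator)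
    then show ?thesis by (simp add: J_def integral_restrict_space)
  qed
  show ?thesis
  \<comment> \<open>The 2 comes from absorbing \<open>Z / 2\<close>, the exponential from undoing
    the weight by time \<open>T\<close>.\<close>
  proof (rule that[of "2 * exp (real n * T)"])
    fix y :: "real \<Rightarrow> real" and a t :: real
    assume a: "0 \<le> a" and bdd: "bdd_above (y ` {0..T})" and pos: "\<And>t. t \<in> {0..T} \<Longrightarrow> 0 \<le> y t"
      and step: "\<And>t g. \<lbrakk>t \<in> {0..T}; continuous_on {0..t} g; \<And>\<tau>. \<tau> \<in> {0..t} \<Longrightarrow> y \<tau> \<le> g \<tau>\<rbrakk>
          \<Longrightarrow> y t \<le> a + b * (\<integral>\<tau>. (t - \<tau>) powr (\<alpha> - 1) * g \<tau> \<partial>lebesgue_on {0..t})"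
      and t: "t \<in> {0..T}"
    define z where "z t = exp (- real n * t) * y t" for t
    define Z where "Z = (SUP t\<in>{0..T}. z t)"
    obtain B where B: "\<And>t. t \<in> {0..T} \<Longrightarrow> y t \<le> B"
      using bdd unfolding bdd_above_def by (metis imageI)
    have "z t \<le> B" if "t \<in> {0..T}" for t
      using that pos[OF that] B[OF that]
      unfolding z_def by (intro order_trans[OF mult_left_le_one_le]) auto
    then have z_le: "z t \<le> Z" if "t \<in> {0..T}" for t
      unfolding Z_def using that by (intro cSUP_upper bdd_aboveI2[where M = B])
    have "z t \<le> a + Z / 2" if t: "t \<in> {0..T}" for t
    proof -
      \<comment> \<open>This majorant is continuous in \<open>\<tau>\<close>, hence admissible as
        \<open>g\<close> in \<open>step\<close> even where \<open>y\<close> itself might not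
        be.\<close>
      have "y \<tau> \<le> Z * exp (real n * \<tau>)" if "\<tau> \<in> {0..t}" for \<tau>
        using z_le[of \<tau>] that t by (simp add: z_def exp_minus field_simps)
      then have "y t \<le> a + b * (\<integral>\<tau>. (t - \<tau>) powr (\<alpha> - 1) * (Z * exp (real n * \<tau>)) \<partial>lebesgue_on {0..t})"
        by (intro step t continuous_intros)
      \<comment> \<open>After reflection the exponential splits into
        \<open>exp (real n * t)\<close>, which the weight in \<open>z\<close> cancels, and the
        factor that produces \<open>J\<close>.\<close>
      also have "(\<integral>\<tau>. (t - \<tau>) powr (\<alpha> - 1) * (Z * exp (real n * \<tau>)) \<partial>lebesgue_on {0..t})
          = (\<integral>s. s powr (\<alpha> - 1) * (Z * exp (real n * (t - s))) \<partial>lebesgue_on {0..t})"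
        using lebesgue_on_reflect(2)[of t "\<lambda>s. s powr (\<alpha> - 1) * (Z * exp (real n * (t - s)))"] by simp
      also have "\<dots> = (\<integral>s. Z * exp (real n * t) * (s powr (\<alpha> - 1) * exp (- real n * s)) \<partial>lebesgue_on {0..t})"
        by (intro Bochner_Integration.integral_cong refl)
          (simp add: right_diff_distrib exp_diff exp_minus field_simps)
      also have "\<dots> = Z * exp (real n * t) * J t n"
        by (simp add: J_def)
      finally have "z t \<le> exp (- real n * t) * (a + b * (Z * exp (real n * t) * J t n))"
        unfolding z_def by (intro mult_left_mono) auto
      also have "\<dots> = exp (- real n * t) * a + Z * (b * J t n)"
        by (simp add: exp_minus field_simps)
      also have "\<dots> \<le> a + Z * (1/2)"
      proof (intro add_mono mult_left_mono)
        show "exp (- real n * t) * a \<le> a" using t a by (intro mult_left_le_one_le) auto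
        show "b * J t n \<le> 1/2" using mult_left_mono[OF J_mono[OF t] assms(3)] n by linarith
        show "0 \<le> Z" using z_le[OF t] pos[OF t] by (auto simp: z_def intro: order_trans[rotated])
      qed
      finally show ?thesis by simp
    qed
    \<comment> \<open>\<open>Z\<close> is a finite supremum, so this inequality can be solved for
      it.\<close>
    then have "Z \<le> a + Z / 2"
      unfolding Z_def using assms(2) by (intro cSUP_least) auto
    then have "z t \<le> 2 * a" using z_le[OF t] by linarith
    then have "y t \<le> 2 * a * exp (real n * t)"
      by (simp add: z_def exp_minus field_simps)
    also have "\<dots> \<le> 2 * a * exp (real n * T)"
      using t a by (intro mult_left_mono) (auto simp: mult_left_mono)
    finally show "y t \<le> 2 * exp (real n * T) * a" by (simp add: mult_ac)
  qed simp
qed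

section \<open>The solution operators\<close>

text \<open>Scalar multipliers: at \<open>c = \<theta> k\<close>, \<open>S_kernel\<close> and
  \<open>R_kernel\<close> are the factors by which \<open>S_op\<close> and \<open>R_op\<close> act
  on the k-th coefficient.\<close>

definition S_kernel :: "real \<Rightarrow> real \<Rightarrow> real \<Rightarrow> real" where
  "S_kernel \<alpha> c t = mittag_leffler \<alpha> 1 (- c * t powr \<alpha> / (1 + c))"

definition R_kernel :: "real \<Rightarrow> real \<Rightarrow> real \<Rightarrow> real" where
  "R_kernel \<alpha> c t = t powr (\<alpha> - 1) / (1 + c) * mittag_leffler \<alpha> \<alpha> (- c * t powr \<alpha> / (1 + c))"

text \<open>c / (1 + c) stays below 1, so the Mittag-Leffler arguments remain in one bounded
  interval for all eigenvalues.\<close>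

lemma kernel_argument_le:
  fixes c t T \<alpha> :: real
  assumes "0 < \<alpha>" "0 \<le> c" "0 \<le> t" "t \<le> T"
  shows "\<bar>- c * t powr \<alpha> / (1 + c)\<bar> \<le> T powr \<alpha>"
proof -
  have "\<bar>- c * t powr \<alpha> / (1 + c)\<bar> = c / (1 + c) * t powr \<alpha>"
    using assms by (simp add: abs_mult)
  also have "\<dots> \<le> 1 * T powr \<alpha>"
    using assms by (intro mult_mono powr_mono2) auto
  finally show ?thesis by simp
qed

lemma abs_S_kernel_le:
  assumes "0 < \<alpha>" "0 \<le> c" "0 \<le> t" "t \<le> T"
  shows "\<bar>S_kernel \<alpha> c t\<bar> \<le> mittag_leffler \<alpha> 1 (T powr \<alpha>)"
  unfolding S_kernel_def by (intro abs_mittag_leffler_le kernel_argument_le assms) simp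

lemma abs_R_kernel_le:
  assumes "0 < \<alpha>" "0 \<le> c" "0 \<le> t" "t \<le> T"
  shows "\<bar>R_kernel \<alpha> c t\<bar> \<le> t powr (\<alpha> - 1) / (1 + c) * mittag_leffler \<alpha> \<alpha> (T powr \<alpha>)"
  unfolding R_kernel_def abs_mult
  using abs_mittag_leffler_le[OF assms(1) assms(1) kernel_argument_le[OF assms]] assms(2)
  by (intro mult_mono) auto

lemma L2_set_le_scale:
  assumes "\<And>i. i \<in> K \<Longrightarrow> \<bar>f i\<bar> \<le> c * \<bar>g i\<bar>" "0 \<le> c"
  shows "L2_set f K \<le> c * L2_set g K"
proof -
  have "L2_set f K = L2_set (\<lambda>i. \<bar>f i\<bar>) K" by (simp add: L2_set_def)
  also have "\<dots> \<le> L2_set (\<lambda>i. c * \<bar>g i\<bar>) K"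
    by (intro L2_set_mono assms) auto
  also have "\<dots> = c * L2_set (\<lambda>i. \<bar>g i\<bar>) K"
    by (rule L2_set_right_distrib[OF assms(2), symmetric])
  also have "L2_set (\<lambda>i. \<bar>g i\<bar>) K = L2_set g K" by (simp add: L2_set_def)
  finally show ?thesis .
qed

section \<open>Solution operators and mild solutions in the eigenbasis\<close>

context dirichlet_eigenbasis
begin

text \<open>Square-summability gives \<open>L2_suminf\<close> a meaning; a bound on the multiplier
  uniform in k secures it for both operators.\<close>

lemma summable_multiplier:
  assumes "w \<in> L2 \<Omega>" "\<And>k. \<bar>m k\<bar> \<le> B"
  shows "summable (\<lambda>k. (m k * L2_inner \<Omega> w (\<phi> k))\<^sup>2)"
proof (rule summable_comparison_test')
  show "summable (\<lambda>k. B\<^sup>2 * (L2_inner \<Omega> w (\<phi> k))\<^sup>2)"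
    by (intro summable_mult summable_coefficients assms(1))
  have "(m k)\<^sup>2 \<le> B\<^sup>2" for k
    using power_mono[OF assms(2)[of k], of 2] by simp
  then show "norm ((m k * L2_inner \<Omega> w (\<phi> k))\<^sup>2) \<le> B\<^sup>2 * (L2_inner \<Omega> w (\<phi> k))\<^sup>2" if "0 \<le> k" for k
    by (simp add: power_mult_distrib mult_right_mono)
qed

lemma S_op_coefficient:
  assumes "0 < \<alpha>" "0 \<le> t" "w \<in> L2 \<Omega>"
  shows "S_op \<Omega> \<theta> \<phi> \<alpha> t w \<in> L2 \<Omega>"
    and "L2_inner \<Omega> (S_op \<Omega> \<theta> \<phi> \<alpha> t w) (\<phi> k) = S_kernel \<alpha> (\<theta> k) t * L2_inner \<Omega> w (\<phi> k)"
proof -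
  have "\<bar>S_kernel \<alpha> (\<theta> k) t\<bar> \<le> mittag_leffler \<alpha> 1 (t powr \<alpha>)" for k
    using assms eigenvalue_pos[of k] by (intro abs_S_kernel_le) auto
  note sm = summable_multiplier[OF assms(3) this]
  show "S_op \<Omega> \<theta> \<phi> \<alpha> t w \<in> L2 \<Omega>"
    using L2_suminf_coefficient(1)[OF sm] by (simp add: S_op_def S_kernel_def)
  show "L2_inner \<Omega> (S_op \<Omega> \<theta> \<phi> \<alpha> t w) (\<phi> k) = S_kernel \<alpha> (\<theta> k) t * L2_inner \<Omega> w (\<phi> k)"
    using L2_suminf_coefficient(2)[OF sm] by (simp add: S_op_def S_kernel_def)
qed

lemma R_op_coefficient:
  assumes "0 < \<alpha>" "0 \<le> t" "w \<in> L2 \<Omega>"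
  shows "L2_inner \<Omega> (R_op \<Omega> \<theta> \<phi> \<alpha> t w) (\<phi> k) = R_kernel \<alpha> (\<theta> k) t * L2_inner \<Omega> w (\<phi> k)"
proof -
  \<comment> \<open>A bound at fixed \<open>t\<close>, for convergence of the series only; at
    \<open>t = 0\<close> both sides vanish because \<open>0 powr x = 0\<close>.\<close>
  have "\<bar>R_kernel \<alpha> (\<theta> k) t\<bar> \<le> t powr (\<alpha> - 1) * mittag_leffler \<alpha> \<alpha> (t powr \<alpha>)" for k
  proof -
    have \<theta>: "0 < \<theta> k" by (rule eigenvalue_pos)
    have "0 \<le> mittag_leffler \<alpha> \<alpha> (t powr \<alpha>)"
      using assms(1) by (simp add: mittag_leffler_nonneg)
    then have "t powr (\<alpha> - 1) / (1 + \<theta> k) * mittag_leffler \<alpha> \<alpha> (t powr \<alpha>)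
        \<le> t powr (\<alpha> - 1) * mittag_leffler \<alpha> \<alpha> (t powr \<alpha>)"
      using \<theta> by (intro mult_right_mono) (auto simp: divide_le_eq intro: mult_left_mono[of 1 _ "t powr (\<alpha> - 1)", simplified])
    then show ?thesis
      using abs_R_kernel_le[of \<alpha> "\<theta> k" t t] \<theta> assms by linarith
  qed
  note sm = summable_multiplier[OF assms(3) this]
  show ?thesis
    using L2_suminf_coefficient(2)[OF sm] by (simp add: R_op_def R_kernel_def)
qed

text \<open>Pairing with \<open>\<phi> k\<close> eliminates the unknown integral \<open>q\<close> of
  the mild formulation, since it commutes with integration and both operators are diagonal.
  \<open>H\<close> enters only through its values in \<open>L2\<close>.\<close>

lemma mild_solution_coefficient:
  assumes \<alpha>: "0 < \<alpha>" and u0: "u0 \<in> L2 \<Omega>" and u: "\<forall>t\<in>{0..T}. u t \<in> L2 \<Omega>"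
    and Hu: "\<forall>t\<in>{0..T}. H (u t) \<in> L2 \<Omega>"
    and mild: "mild_solution \<Omega> \<theta> \<phi> \<alpha> H u0 T u" and t: "t \<in> {0..T}"
  shows "integrable (lebesgue_on {0..t}) (\<lambda>\<tau>. R_kernel \<alpha> (\<theta> k) (t - \<tau>) * L2_inner \<Omega> (H (u \<tau>)) (\<phi> k))"
    and "L2_inner \<Omega> (u t) (\<phi> k) = S_kernel \<alpha> (\<theta> k) t * L2_inner \<Omega> u0 (\<phi> k)
      + (\<integral>\<tau>. R_kernel \<alpha> (\<theta> k) (t - \<tau>) * L2_inner \<Omega> (H (u \<tau>)) (\<phi> k) \<partial>lebesgue_on {0..t})"
proof -
  obtain q where q: "has_L2_integral \<Omega> (lebesgue_on {0..t}) (\<lambda>\<tau>. R_op \<Omega> \<theta> \<phi> \<alpha> (t - \<tau>) (H (u \<tau>))) q"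
    and ut: "L2_eq \<Omega> (u t) (\<lambda>x. S_op \<Omega> \<theta> \<phi> \<alpha> t u0 x + q x)"
    using mild t unfolding mild_solution_def by blast
  have "L2_norm \<Omega> (\<phi> k) \<le> 1" by (simp add: L2_norm_def orthonormal)
  note I = has_L2_integral_inner[OF _ q basis_L2 this, simplified]
  have R: "L2_inner \<Omega> (R_op \<Omega> \<theta> \<phi> \<alpha> (t - \<tau>) (H (u \<tau>))) (\<phi> k)
      = R_kernel \<alpha> (\<theta> k) (t - \<tau>) * L2_inner \<Omega> (H (u \<tau>)) (\<phi> k)" if "\<tau> \<in> {0..t}" for \<tau>
    using that t \<alpha> by (intro R_op_coefficient Hu[rule_format]) auto
  show "integrable (lebesgue_on {0..t}) (\<lambda>\<tau>. R_kernel \<alpha> (\<theta> k) (t - \<tau>) * L2_inner \<Omega> (H (u \<tau>)) (\<phi> k))"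
    using I(1) by (rule Bochner_Integration.integrable_cong[THEN iffD1, rotated -1]) (auto simp: R)
  have "(\<integral>\<tau>. R_kernel \<alpha> (\<theta> k) (t - \<tau>) * L2_inner \<Omega> (H (u \<tau>)) (\<phi> k) \<partial>lebesgue_on {0..t}) = L2_inner \<Omega> q (\<phi> k)"
    unfolding I(2)[symmetric] by (intro Bochner_Integration.integral_cong) (auto simp: R)
  moreover have S: "S_op \<Omega> \<theta> \<phi> \<alpha> t u0 \<in> L2 \<Omega>"
    "L2_inner \<Omega> (S_op \<Omega> \<theta> \<phi> \<alpha> t u0) (\<phi> k) = S_kernel \<alpha> (\<theta> k) t * L2_inner \<Omega> u0 (\<phi> k)"
    using S_op_coefficient[OF \<alpha> _ u0] t by auto
  moreover have "L2_inner \<Omega> (u t) (\<phi> k) = L2_inner \<Omega> (\<lambda>x. S_op \<Omega> \<theta> \<phi> \<alpha> t u0 x + q x) (\<phi> k)"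
    by (intro L2_inner_cong_AE ut u[rule_format] t L2_add S(1) I(3) basis_L2)
  ultimately show "L2_inner \<Omega> (u t) (\<phi> k) = S_kernel \<alpha> (\<theta> k) t * L2_inner \<Omega> u0 (\<phi> k)
      + (\<integral>\<tau>. R_kernel \<alpha> (\<theta> k) (t - \<tau>) * L2_inner \<Omega> (H (u \<tau>)) (\<phi> k) \<partial>lebesgue_on {0..t})"
    using I(3) by (simp add: L2_inner_add_left basis_L2)
qed

text \<open>By the reverse triangle inequality the norm along \<open>u\<close> is continuous, and
  the interval is compact. Boundedness makes the supremum in the Gronwall argument finite.\<close>

lemma CD_space_bounded:
  assumes "u \<in> CD_space \<Omega> \<theta> \<phi> 1 {0..T}"
  shows "bdd_above ((\<lambda>t. D_norm \<Omega> \<theta> \<phi> 1 (u t)) ` {0..T})"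
proof -
  have D: "u t \<in> D_space \<Omega> \<theta> \<phi> 1" if "t \<in> {0..T}" for t
    using assms that by (simp add: CD_space_def)
  have "continuous_on {0..T} (\<lambda>t. D_norm \<Omega> \<theta> \<phi> 1 (u t))"
    unfolding continuous_on_def
  proof
    fix t assume t: "t \<in> {0..T}"
    let ?d = "\<lambda>s. D_norm \<Omega> \<theta> \<phi> 1 (\<lambda>x. u s x - u t x)"
    have le: "\<bar>D_norm \<Omega> \<theta> \<phi> 1 (u s) - D_norm \<Omega> \<theta> \<phi> 1 (u t)\<bar> \<le> ?d s" if s: "s \<in> {0..T}" for s
    proof -
      note [simp] = L2_inner_diff_left[OF _ _ basis_L2]
      have L2: "u s \<in> L2 \<Omega>" "u t \<in> L2 \<Omega>"
        using D[OF s] D[OF t] by (simp_all add: D_space_1_iff)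
      have "D_norm \<Omega> \<theta> \<phi> 1 (u s) \<le> ?d s + D_norm \<Omega> \<theta> \<phi> 1 (u t)"
        using L2 by (intro D_norm_le_add D_space_diff D s t) simp
      moreover have "D_norm \<Omega> \<theta> \<phi> 1 (u t) \<le> ?d s + D_norm \<Omega> \<theta> \<phi> 1 (u s)"
        using L2 by (intro D_norm_le_add D_space_diff D s t) simp
      ultimately show ?thesis by linarith
    qed
    show "((\<lambda>s. D_norm \<Omega> \<theta> \<phi> 1 (u s)) \<longlongrightarrow> D_norm \<Omega> \<theta> \<phi> 1 (u t)) (at t within {0..T})"
    proof (rule LIM_zero_cancel, rule Lim_null_comparison)
      show "(?d \<longlongrightarrow> 0) (at t within {0..T})"
        using assms t by (simp add: CD_space_def)
      show "\<forall>\<^sub>F s in at t within {0..T}. norm (D_norm \<Omega> \<theta> \<phi> 1 (u s) - D_norm \<Omega> \<theta> \<phi> 1 (u t)) \<le> ?d s"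
        using le by (auto simp: eventually_at_filter)
    qed
  qed
  then have "compact ((\<lambda>t. D_norm \<Omega> \<theta> \<phi> 1 (u t)) ` {0..T})"
    by (rule compact_continuous_image) simp
  then show ?thesis
    by (intro bounded_imp_bdd_above compact_imp_bounded)
qed

lemma sqrt_R_kernel_le:
  assumes "0 < \<alpha>" "0 \<le> s" "s \<le> T"
  shows "\<bar>sqrt (\<theta> k) * R_kernel \<alpha> (\<theta> k) s\<bar> \<le> mittag_leffler \<alpha> \<alpha> (T powr \<alpha>) * s powr (\<alpha> - 1)"
proof -
  let ?M = "mittag_leffler \<alpha> \<alpha> (T powr \<alpha>)"
  have \<theta>: "0 < \<theta> k" by (rule eigenvalue_pos)
  have M: "0 \<le> ?M"
    using assms(1) by (simp add: mittag_leffler_nonneg)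
  have "sqrt (\<theta> k) \<le> 1 + \<theta> k"
    using \<theta> by (intro real_le_lsqrt) (auto simp: power2_eq_square algebra_simps)
  then have "sqrt (\<theta> k) / (1 + \<theta> k) \<le> 1"
    using \<theta> by simp
  then have "sqrt (\<theta> k) / (1 + \<theta> k) * (?M * s powr (\<alpha> - 1)) \<le> ?M * s powr (\<alpha> - 1)"
    using M \<theta> by (intro mult_left_le_one_le) auto
  moreover have "\<bar>sqrt (\<theta> k) * R_kernel \<alpha> (\<theta> k) s\<bar> \<le> sqrt (\<theta> k) * (s powr (\<alpha> - 1) / (1 + \<theta> k) * ?M)"
    using mult_left_mono[OF abs_R_kernel_le[OF assms(1) less_imp_le[OF \<theta>] assms(2,3)], of "sqrt (\<theta> k)"] \<theta>
    by (simp add: abs_mult)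
  ultimately show ?thesis by (simp add: mult_ac)
qed

text \<open>\<open>K\<close> is built from \<alpha>, \<open>T\<close> and \<eta> before data and
  solutions appear. One constant therefore serves uniqueness, with equal data, and continuous
  dependence.\<close>

lemma mild_solution_stability:
  assumes \<alpha>: "0 < \<alpha>" and T: "0 \<le> T"
  obtains K where "K > 0"
    and "\<And>u0 v0 u v t. \<lbrakk>u0 \<in> D_space \<Omega> \<theta> \<phi> 1; v0 \<in> D_space \<Omega> \<theta> \<phi> 1;
        u \<in> CD_space \<Omega> \<theta> \<phi> 1 {0..T}; v \<in> CD_space \<Omega> \<theta> \<phi> 1 {0..T};
        mild_solution \<Omega> \<theta> \<phi> \<alpha> (convection \<Omega> \<eta>) u0 T u;
        mild_solution \<Omega> \<theta> \<phi> \<alpha> (convection \<Omega> \<eta>) v0 T v; t \<in> {0..T}\<rbrakk>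
      \<Longrightarrow> D_norm \<Omega> \<theta> \<phi> 1 (\<lambda>x. v t x - u t x) \<le> K * D_norm \<Omega> \<theta> \<phi> 1 (\<lambda>x. v0 x - u0 x)"
proof -
  define M1 where "M1 = mittag_leffler \<alpha> 1 (T powr \<alpha>)"
  define M2 where "M2 = mittag_leffler \<alpha> \<alpha> (T powr \<alpha>)"
  define C where "C = (\<Sum>j\<in>UNIV. \<bar>\<eta> $ j\<bar>)"
  have M: "0 \<le> M1" "0 \<le> M2"
    using \<alpha> by (simp_all add: M1_def M2_def mittag_leffler_nonneg)
  have C: "0 \<le> C" by (simp add: C_def sum_nonneg)
  obtain K where K: "K > 0" and Gronwall:
    "\<And>y a t. \<lbrakk>0 \<le> a; bdd_above (y ` {0..T}); \<And>t. t \<in> {0..T} \<Longrightarrow> 0 \<le> y t;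
        \<And>t g. \<lbrakk>t \<in> {0..T}; continuous_on {0..t} g; \<And>\<tau>. \<tau> \<in> {0..t} \<Longrightarrow> y \<tau> \<le> g \<tau>\<rbrakk>
          \<Longrightarrow> y t \<le> a + M2 * C * (\<integral>\<tau>. (t - \<tau>) powr (\<alpha> - 1) * g \<tau> \<partial>lebesgue_on {0..t});
        t \<in> {0..T}\<rbrakk> \<Longrightarrow> y t \<le> K * a"
    by (rule weakly_singular_Gronwall[OF \<alpha> T mult_nonneg_nonneg[OF M(2) C]]) blast
  show ?thesis
  \<comment> \<open>\<open>M1\<close> bounds \<open>S_kernel\<close> and so controls the
    contribution of the data; the added 1 makes the constant positive.\<close>
  proof (rule that[of "K * (M1 + 1)"])
    show "0 < K * (M1 + 1)" using K M(1) by simp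
    fix u0 v0 u v t
    assume u0: "u0 \<in> D_space \<Omega> \<theta> \<phi> 1" and v0: "v0 \<in> D_space \<Omega> \<theta> \<phi> 1"
      and u: "u \<in> CD_space \<Omega> \<theta> \<phi> 1 {0..T}" and v: "v \<in> CD_space \<Omega> \<theta> \<phi> 1 {0..T}"
      and mild_u: "mild_solution \<Omega> \<theta> \<phi> \<alpha> (convection \<Omega> \<eta>) u0 T u"
      and mild_v: "mild_solution \<Omega> \<theta> \<phi> \<alpha> (convection \<Omega> \<eta>) v0 T v"
      and t: "t \<in> {0..T}"
    have uD: "u t \<in> D_space \<Omega> \<theta> \<phi> 1" and vD: "v t \<in> D_space \<Omega> \<theta> \<phi> 1" if "t \<in> {0..T}" for t
      using u v that by (simp_all add: CD_space_def)
    have L2: "w \<in> L2 \<Omega>" if "w \<in> D_space \<Omega> \<theta> \<phi> 1" for w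
      using that by (simp add: D_space_1_iff)
    let ?D = "D_norm \<Omega> \<theta> \<phi> 1 (\<lambda>x. v0 x - u0 x)"
    let ?H = "convection \<Omega> \<eta>"
    define y where "y t = D_norm \<Omega> \<theta> \<phi> 1 (\<lambda>x. v t x - u t x)" for t
    define h where "h t = (\<lambda>x. ?H (v t) x - ?H (u t) x)" for t
    have D_nonneg: "0 \<le> ?D" by (intro D_norm_1_nonneg D_space_diff u0 v0)
    have u_L2: "\<forall>t\<in>{0..T}. u t \<in> L2 \<Omega>" and v_L2: "\<forall>t\<in>{0..T}. v t \<in> L2 \<Omega>"
      and Hu_L2: "\<forall>t\<in>{0..T}. ?H (u t) \<in> L2 \<Omega>" and Hv_L2: "\<forall>t\<in>{0..T}. ?H (v t) \<in> L2 \<Omega>"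
      using L2 convection_L2 uD vD by blast+
    have h_L2: "h t \<in> L2 \<Omega>" if "t \<in> {0..T}" for t
      unfolding h_def by (intro L2_diff convection_L2 uD vD that)
    have h_le: "L2_norm \<Omega> (h t) \<le> C * y t" if "t \<in> {0..T}" for t
      unfolding h_def y_def C_def by (intro convection_Lipschitz uD vD that)
    have y_le: "y t \<le> D_norm \<Omega> \<theta> \<phi> 1 (v t) + D_norm \<Omega> \<theta> \<phi> 1 (u t)" if "t \<in> {0..T}" for t
      unfolding y_def using that
      by (intro D_norm_le_add uD vD) (simp_all add: L2_inner_diff_left L2 uD vD basis_L2)
    have "y t \<le> K * (M1 * ?D)"
    proof (rule Gronwall[of _ y])
      show "0 \<le> M1 * ?D" using M D_nonneg by simp
      obtain A where A: "\<And>r. r \<in> (\<lambda>t. D_norm \<Omega> \<theta> \<phi> 1 (u t)) ` {0..T} \<Longrightarrow> r \<le> A"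
        using CD_space_bounded[OF u] unfolding bdd_above_def by blast
      obtain B where B: "\<And>r. r \<in> (\<lambda>t. D_norm \<Omega> \<theta> \<phi> 1 (v t)) ` {0..T} \<Longrightarrow> r \<le> B"
        using CD_space_bounded[OF v] unfolding bdd_above_def by blast
      have "y t \<le> B + A" if "t \<in> {0..T}" for t
        using y_le[OF that] A[OF imageI[OF that]] B[OF imageI[OF that]] by linarith
      then show "bdd_above (y ` {0..T})"
        by (rule bdd_aboveI2)
      show "0 \<le> y t" if "t \<in> {0..T}" for t
        unfolding y_def by (intro D_norm_1_nonneg D_space_diff uD vD that)
    next
      fix t g assume t: "t \<in> {0..T}" and g: "continuous_on {0..t} g"
        and y_g: "\<And>\<tau>. \<tau> \<in> {0..t} \<Longrightarrow> y \<tau> \<le> g \<tau>"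
      \<comment> \<open>The k-th coefficient of the difference of the integrands, weighted as in the
        D^1 norm.\<close>
      define f where "f k \<tau> = sqrt (\<theta> k) * (R_kernel \<alpha> (\<theta> k) (t - \<tau>) * L2_inner \<Omega> (h \<tau>) (\<phi> k))" for k \<tau>
      let ?G = "\<lambda>\<tau>. M2 * C * ((t - \<tau>) powr (\<alpha> - 1) * g \<tau>)"
      note coef_u = mild_solution_coefficient[of \<alpha> u0 T u ?H, OF \<alpha> L2[OF u0] u_L2 Hu_L2 mild_u t]
      note coef_v = mild_solution_coefficient[of \<alpha> v0 T v ?H, OF \<alpha> L2[OF v0] v_L2 Hv_L2 mild_v t]
      have f_eq: "f k \<tau> = sqrt (\<theta> k) * (R_kernel \<alpha> (\<theta> k) (t - \<tau>) * L2_inner \<Omega> (?H (v \<tau>)) (\<phi> k)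
          - R_kernel \<alpha> (\<theta> k) (t - \<tau>) * L2_inner \<Omega> (?H (u \<tau>)) (\<phi> k))" if "\<tau> \<in> {0..t}" for k \<tau>
        using that t
        by (simp add: f_def h_def L2_inner_diff_left convection_L2 uD vD basis_L2 right_diff_distrib)
      have f_int: "integrable (lebesgue_on {0..t}) (f k)" for k
        using f_eq by (subst Bochner_Integration.integrable_cong[OF refl f_eq])
          (auto intro!: coef_u(1) coef_v(1))
      have f_integral: "(\<integral>\<tau>. f k \<tau> \<partial>lebesgue_on {0..t})
          = sqrt (\<theta> k) * ((\<integral>\<tau>. R_kernel \<alpha> (\<theta> k) (t - \<tau>) * L2_inner \<Omega> (?H (v \<tau>)) (\<phi> k) \<partial>lebesgue_on {0..t})
            - (\<integral>\<tau>. R_kernel \<alpha> (\<theta> k) (t - \<tau>) * L2_inner \<Omega> (?H (u \<tau>)) (\<phi> k) \<partial>lebesgue_on {0..t}))" for k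
        using Bochner_Integration.integral_diff[OF coef_v(1) coef_u(1), of k k]
        by (subst Bochner_Integration.integral_cong[OF refl f_eq]) auto
      have coef: "sqrt (\<theta> k) * L2_inner \<Omega> (\<lambda>x. v t x - u t x) (\<phi> k)
          = S_kernel \<alpha> (\<theta> k) t * (sqrt (\<theta> k) * L2_inner \<Omega> (\<lambda>x. v0 x - u0 x) (\<phi> k))
            + (\<integral>\<tau>. f k \<tau> \<partial>lebesgue_on {0..t})" for k
        using L2[OF u0] L2[OF v0] L2[OF uD[OF t]] L2[OF vD[OF t]]
        by (simp add: L2_inner_diff_left basis_L2 f_integral coef_u(2) coef_v(2) algebra_simps)
      \<comment> \<open>A bound independent of \<open>n\<close>, which \<open>D_norm_le\<close>
        lifts to the full norm.\<close>
      have "L2_set (\<lambda>k. sqrt (\<theta> k) * L2_inner \<Omega> (\<lambda>x. v t x - u t x) (\<phi> k)) {..<n}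
          \<le> M1 * ?D + M2 * C * (\<integral>\<tau>. (t - \<tau>) powr (\<alpha> - 1) * g \<tau> \<partial>lebesgue_on {0..t})" for n
      proof -
        have "L2_set (\<lambda>k. S_kernel \<alpha> (\<theta> k) t * (sqrt (\<theta> k) * L2_inner \<Omega> (\<lambda>x. v0 x - u0 x) (\<phi> k))) {..<n}
            \<le> M1 * L2_set (\<lambda>k. sqrt (\<theta> k) * L2_inner \<Omega> (\<lambda>x. v0 x - u0 x) (\<phi> k)) {..<n}"
        proof (rule L2_set_le_scale[OF _ M(1)])
          fix k
          have "\<bar>S_kernel \<alpha> (\<theta> k) t\<bar> \<le> M1"
            unfolding M1_def using t \<alpha> eigenvalue_pos[of k] by (intro abs_S_kernel_le) auto
          then show "\<bar>S_kernel \<alpha> (\<theta> k) t * (sqrt (\<theta> k) * L2_inner \<Omega> (\<lambda>x. v0 x - u0 x) (\<phi> k))\<bar>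
              \<le> M1 * \<bar>sqrt (\<theta> k) * L2_inner \<Omega> (\<lambda>x. v0 x - u0 x) (\<phi> k)\<bar>"
            by (subst abs_mult) (intro mult_right_mono, auto)
        qed
        also have "\<dots> \<le> M1 * ?D"
          by (intro mult_left_mono L2_set_le_D_norm D_space_diff u0 v0 M)
        finally have 1: "L2_set (\<lambda>k. S_kernel \<alpha> (\<theta> k) t * (sqrt (\<theta> k) * L2_inner \<Omega> (\<lambda>x. v0 x - u0 x) (\<phi> k))) {..<n} \<le> M1 * ?D" .
        \<comment> \<open>Minkowski's inequality moves the coefficient norm inside the time
          integral, where the kernel bound is the same for all k and factors out.\<close>
        have "L2_set (\<lambda>k. \<integral>\<tau>. f k \<tau> \<partial>lebesgue_on {0..t}) {..<n} \<le> (\<integral>\<tau>. ?G \<tau> \<partial>lebesgue_on {0..t})"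
        proof (rule L2_set_integral_le[OF f_int])
          show "integrable (lebesgue_on {0..t}) ?G"
            using t by (intro integrable_mult_right integrable_weakly_singular \<alpha> g) auto
          fix \<tau> assume "\<tau> \<in> space (lebesgue_on {0..t})"
          then have \<tau>: "\<tau> \<in> {0..t}" and \<tau>': "\<tau> \<in> {0..T}" using t by auto
          let ?w = "(t - \<tau>) powr (\<alpha> - 1)"
          have "L2_set (\<lambda>k. f k \<tau>) {..<n} \<le> M2 * ?w * L2_set (\<lambda>k. L2_inner \<Omega> (h \<tau>) (\<phi> k)) {..<n}"
          proof (rule L2_set_le_scale)
            fix k
            have "\<bar>sqrt (\<theta> k) * R_kernel \<alpha> (\<theta> k) (t - \<tau>)\<bar> \<le> M2 * ?w"
              unfolding M2_def using \<tau> t \<alpha> by (intro sqrt_R_kernel_le) auto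
            then show "\<bar>f k \<tau>\<bar> \<le> M2 * ?w * \<bar>L2_inner \<Omega> (h \<tau>) (\<phi> k)\<bar>"
              unfolding f_def mult.assoc[symmetric] by (subst abs_mult) (intro mult_right_mono, auto)
          qed (use M in simp)
          also have "\<dots> \<le> M2 * ?w * (C * g \<tau>)"
          proof (rule mult_left_mono)
            \<comment> \<open>Bessel removes the dependence on \<open>n\<close>; then the Lipschitz
              bound and \<open>y \<le> g\<close> apply.\<close>
            have "L2_set (\<lambda>k. L2_inner \<Omega> (h \<tau>) (\<phi> k)) {..<n} \<le> L2_norm \<Omega> (h \<tau>)"
              unfolding L2_set_def by (intro real_le_lsqrt Bessel h_L2 \<tau>') simp_all
            also have "\<dots> \<le> C * g \<tau>"
              using h_le[OF \<tau>'] mult_left_mono[OF y_g[OF \<tau>] C] by linarith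
            finally show "L2_set (\<lambda>k. L2_inner \<Omega> (h \<tau>) (\<phi> k)) {..<n} \<le> C * g \<tau>" .
          qed (use M in simp)
          finally show "L2_set (\<lambda>k. f k \<tau>) {..<n} \<le> ?G \<tau>"
            by (simp add: mult_ac)
        qed
        then have 2: "L2_set (\<lambda>k. \<integral>\<tau>. f k \<tau> \<partial>lebesgue_on {0..t}) {..<n}
            \<le> M2 * C * (\<integral>\<tau>. (t - \<tau>) powr (\<alpha> - 1) * g \<tau> \<partial>lebesgue_on {0..t})" by simp
        show ?thesis
          unfolding coef using order_trans[OF L2_set_triangle_ineq add_mono[OF 1 2]] .
      qed
      then show "y t \<le> M1 * ?D + M2 * C * (\<integral>\<tau>. (t - \<tau>) powr (\<alpha> - 1) * g \<tau> \<partial>lebesgue_on {0..t})"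
        unfolding y_def by (rule D_norm_le)
    qed (rule t)
    also have "\<dots> \<le> K * (M1 + 1) * ?D"
      using K D_nonneg by (simp add: distrib_left distrib_right mult.assoc)
    finally show "D_norm \<Omega> \<theta> \<phi> 1 (\<lambda>x. v t x - u t x) \<le> K * (M1 + 1) * ?D"
      by (simp add: y_def)
  qed
qed

text \<open>Membership makes the series of nonnegative terms convergent, so a vanishing sum kills
  each term, and the eigenvalues are positive.\<close>

lemma D_norm_eq_0_imp:
  assumes "w \<in> D_space \<Omega> \<theta> \<phi> 1" "D_norm \<Omega> \<theta> \<phi> 1 w \<le> 0"
  shows "L2_inner \<Omega> w (\<phi> k) = 0"
proof -
  have "(\<Sum>k. \<theta> k * (L2_inner \<Omega> w (\<phi> k))\<^sup>2) = 0"
    using assms D_norm_1_nonneg[OF assms(1)] D_norm_1_power2[OF assms(1)] by simp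
  then have "\<theta> k * (L2_inner \<Omega> w (\<phi> k))\<^sup>2 = 0"
    using assms(1) eigenvalue_pos
    by (subst (asm) suminf_eq_zero_iff) (auto simp: D_space_1_iff less_imp_le)
  then show ?thesis using eigenvalue_pos[of k] by simp
qed

end

theorem theorem3p4:
  fixes \<Omega> :: "(real^'d::finite) set" and \<eta> :: "real^'d"
    and \<theta> :: "nat \<Rightarrow> real" and \<phi> :: "nat \<Rightarrow> real^'d \<Rightarrow> real"
    and \<alpha> T :: real and u0 :: "real^'d \<Rightarrow> real" and u :: "real \<Rightarrow> real^'d \<Rightarrow> real"
  assumes "0 < \<alpha>" and "\<alpha> < 1"
    and "bounded_smooth_domain \<Omega>"
    and "dirichlet_eigensystem \<Omega> \<theta> \<phi>"
    and "0 < T"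
    and "u0 \<in> D_space \<Omega> \<theta> \<phi> 1"
    and "u \<in> CD_space \<Omega> \<theta> \<phi> 1 {0..T}"
    and "mild_solution \<Omega> \<theta> \<phi> \<alpha> (convection \<Omega> \<eta>) u0 T u"
  shows "(\<forall>v. v \<in> CD_space \<Omega> \<theta> \<phi> 1 {0..T} \<and> mild_solution \<Omega> \<theta> \<phi> \<alpha> (convection \<Omega> \<eta>) u0 T v
            \<longrightarrow> (\<forall>t\<in>{0..T}. L2_eq \<Omega> (v t) (u t)))
       \<and> (\<forall>\<epsilon>>0. \<exists>\<delta>>0. \<forall>v0 v. v0 \<in> D_space \<Omega> \<theta> \<phi> 1
            \<and> D_norm \<Omega> \<theta> \<phi> 1 (\<lambda>x. v0 x - u0 x) < \<delta>
            \<and> v \<in> CD_space \<Omega> \<theta> \<phi> 1 {0..T}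
            \<and> mild_solution \<Omega> \<theta> \<phi> \<alpha> (convection \<Omega> \<eta>) v0 T v
            \<longrightarrow> CD_norm \<Omega> \<theta> \<phi> 1 {0..T} (\<lambda>t x. v t x - u t x) < \<epsilon>)"
proof -
  interpret dirichlet_eigenbasis \<Omega> \<theta> \<phi>
    using assms(3,4) by unfold_locales (auto simp: bounded_smooth_domain_def)
  have T: "0 \<le> T" using assms(5) by simp
  obtain K where K: "K > 0" and stable:
    "\<And>v0 v t. \<lbrakk>v0 \<in> D_space \<Omega> \<theta> \<phi> 1; v \<in> CD_space \<Omega> \<theta> \<phi> 1 {0..T};
        mild_solution \<Omega> \<theta> \<phi> \<alpha> (convection \<Omega> \<eta>) v0 T v; t \<in> {0..T}\<rbrakk>
      \<Longrightarrow> D_norm \<Omega> \<theta> \<phi> 1 (\<lambda>x. v t x - u t x) \<le> K * D_norm \<Omega> \<theta> \<phi> 1 (\<lambda>x. v0 x - u0 x)"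
    by (rule mild_solution_stability[OF assms(1) T, of \<eta>]) (use assms(6-8) in blast)
  have D: "w t \<in> D_space \<Omega> \<theta> \<phi> 1" if "w \<in> CD_space \<Omega> \<theta> \<phi> 1 {0..T}" "t \<in> {0..T}" for w t
    using that by (simp add: CD_space_def)
  show ?thesis
  proof (intro conjI allI impI ballI)
    fix v t
    assume v: "v \<in> CD_space \<Omega> \<theta> \<phi> 1 {0..T} \<and> mild_solution \<Omega> \<theta> \<phi> \<alpha> (convection \<Omega> \<eta>) u0 T v"
      and t: "t \<in> {0..T}"
    have vt: "v t \<in> D_space \<Omega> \<theta> \<phi> 1" and ut: "u t \<in> D_space \<Omega> \<theta> \<phi> 1"
      using D v assms(7) t by auto
    \<comment> \<open>With equal data the stability bound is \<open>K\<close> times the norm of the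
      zero function.\<close>
    have "D_norm \<Omega> \<theta> \<phi> 1 (\<lambda>x. v t x - u t x) \<le> 0"
      using stable[OF assms(6), of v t] v t by (simp add: D_norm_1)
    then have "L2_inner \<Omega> (\<lambda>x. v t x - u t x) (\<phi> k) = 0" for k
      by (intro D_norm_eq_0_imp D_space_diff vt ut)
    then show "L2_eq \<Omega> (v t) (u t)"
      using vt ut by (intro L2_eqI) (auto simp: D_space_1_iff L2_inner_diff_left basis_L2)
  next
    fix \<epsilon> :: real assume \<epsilon>: "0 < \<epsilon>"
    show "\<exists>\<delta>>0. \<forall>v0 v. v0 \<in> D_space \<Omega> \<theta> \<phi> 1
            \<and> D_norm \<Omega> \<theta> \<phi> 1 (\<lambda>x. v0 x - u0 x) < \<delta>
            \<and> v \<in> CD_space \<Omega> \<theta> \<phi> 1 {0..T}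
            \<and> mild_solution \<Omega> \<theta> \<phi> \<alpha> (convection \<Omega> \<eta>) v0 T v
            \<longrightarrow> CD_norm \<Omega> \<theta> \<phi> 1 {0..T} (\<lambda>t x. v t x - u t x) < \<epsilon>"
    proof (intro exI[of _ "\<epsilon> / K"] conjI allI impI)
      show "0 < \<epsilon> / K" using \<epsilon> K by simp
      fix v0 v
      assume v: "v0 \<in> D_space \<Omega> \<theta> \<phi> 1
            \<and> D_norm \<Omega> \<theta> \<phi> 1 (\<lambda>x. v0 x - u0 x) < \<epsilon> / K
            \<and> v \<in> CD_space \<Omega> \<theta> \<phi> 1 {0..T}
            \<and> mild_solution \<Omega> \<theta> \<phi> \<alpha> (convection \<Omega> \<eta>) v0 T v"
      \<comment> \<open>A supremum inherits only a weak inequality; strictness comes from the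
        initial data. \<open>0 \<le> T\<close> makes the interval nonempty.\<close>
      have "CD_norm \<Omega> \<theta> \<phi> 1 {0..T} (\<lambda>t x. v t x - u t x) \<le> K * D_norm \<Omega> \<theta> \<phi> 1 (\<lambda>x. v0 x - u0 x)"
        unfolding CD_norm_def using T v by (intro cSUP_least stable) auto
      also have "\<dots> < \<epsilon>"
        using v K by (simp add: field_simps)
      finally show "CD_norm \<Omega> \<theta> \<phi> 1 {0..T} (\<lambda>t x. v t x - u t x) < \<epsilon>" .
    qed
  qed
qed

end
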